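(* Let $m,n\geq 1$ be integers such that the free Burnside group $B(m,n)$ is infinite. Then, for every integer $k>1$, the free Burnside group $B(m,kn)$ acts without fixed points on a CAT(0) cubical complex, and hence does not have Kazhdan's property (T).
   Context: The free Burnside group $B(m,n)$ is the group defined by the presentation $\langle s_1,s_2,\ldots,s_m \mid w(s_1,s_2,\ldots,s_m)^n\rangle$, where $w$ runs over all words in $s_1,\ldots,s_m$ (and their inverses). Actions on cubical complexes are by cubical automorphisms; the complex may be infinite-dimensional. *)

theory Defs
  imports "HOL-Analysis.Analysis" "HOL-Algebra.Module" "HOL-Algebra.Group_Action"
begin

text \<open>A letter \<open>(s, True)\<close> stands for the generator \<open>s\<close> and \<open>(s, False)\<close> for its inverse.\<close>

type_synonym 'a word = "('a \<times> bool) list"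

definition words :: "'a set \<Rightarrow> 'a word set"
  where "words S = lists (S \<times> UNIV)"

inductive pres_eq :: "'a set \<Rightarrow> 'a word set \<Rightarrow> 'a word \<Rightarrow> 'a word \<Rightarrow> bool" for S R
  where
    refl: "w \<in> words S \<Longrightarrow> pres_eq S R w w"
  | sym: "pres_eq S R v w \<Longrightarrow> pres_eq S R w v"
  | trans: "pres_eq S R u v \<Longrightarrow> pres_eq S R v w \<Longrightarrow> pres_eq S R u w"
  | cancel: "u \<in> words S \<Longrightarrow> v \<in> words S \<Longrightarrow> s \<in> S \<Longrightarrow>
      pres_eq S R (u @ [(s, b), (s, \<not> b)] @ v) (u @ v)"
  | relator: "u \<in> words S \<Longrightarrow> v \<in> words S \<Longrightarrow> r \<in> R \<Longrightarrow> r \<in> words S \<Longrightarrow>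
      pres_eq S R (u @ r @ v) (u @ v)"

definition presented_group :: "'a set \<Rightarrow> 'a word set \<Rightarrow> 'a word set monoid"
  where "presented_group S R =
    \<lparr> carrier = words S // {(v, w). pres_eq S R v w},
      mult = (\<lambda>A B. {w. \<exists>u\<in>A. \<exists>v\<in>B. pres_eq S R (u @ v) w}),
      one = {w. pres_eq S R [] w} \<rparr>"

definition burnside_group :: "nat \<Rightarrow> nat \<Rightarrow> nat word set monoid"
  where "burnside_group m n =
    presented_group {1..m} {concat (replicate n w) | w. w \<in> words {1..m}}"

definition geodesic_from_to :: "'a set \<Rightarrow> ('a \<Rightarrow> 'a \<Rightarrow> real) \<Rightarrow> (real \<Rightarrow> 'a) \<Rightarrow> 'a \<Rightarrow> 'a \<Rightarrow> bool"
  where "geodesic_from_to M d \<gamma> x y \<longleftrightarrow>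
    \<gamma> ` {0..d x y} \<subseteq> M \<and> \<gamma> 0 = x \<and> \<gamma> (d x y) = y \<and>
    (\<forall>s\<in>{0..d x y}. \<forall>t\<in>{0..d x y}. d (\<gamma> s) (\<gamma> t) = \<bar>s - t\<bar>)"

definition geodesic_space :: "'a set \<Rightarrow> ('a \<Rightarrow> 'a \<Rightarrow> real) \<Rightarrow> bool"
  where "geodesic_space M d \<longleftrightarrow>
    Metric_space M d \<and> (\<forall>x\<in>M. \<forall>y\<in>M. \<exists>\<gamma>. geodesic_from_to M d \<gamma> x y)"

text \<open>
  The points \<open>p'\<close>, \<open>q'\<close>, \<open>r'\<close> span a comparison triangle in the Euclidean plane, and \<open>x'\<close>, \<open>y'\<close> are
  the comparison points of \<open>\<gamma> s\<close>, \<open>\<delta> t\<close>. Since any two sides of a geodesic triangle share a vertex,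
  and since the vertices are arbitrary, it suffices to name the two sides that issue from \<open>p\<close>.
\<close>

definition CAT0_space :: "'a set \<Rightarrow> ('a \<Rightarrow> 'a \<Rightarrow> real) \<Rightarrow> bool"
  where "CAT0_space M d \<longleftrightarrow> geodesic_space M d \<and>
    (\<forall>p\<in>M. \<forall>q\<in>M. \<forall>r\<in>M. \<forall>\<gamma> \<delta>.
      geodesic_from_to M d \<gamma> p q \<longrightarrow> geodesic_from_to M d \<delta> p r \<longrightarrow>
      (\<forall>p' q' r' :: real^2.
        dist p' q' = d p q \<longrightarrow> dist q' r' = d q r \<longrightarrow> dist p' r' = d p r \<longrightarrow>
        (\<forall>s\<in>{0..d p q}. \<forall>t\<in>{0..d p r}.
          \<forall>x'\<in>closed_segment p' q'. \<forall>y'\<in>closed_segment p' r'.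
            dist p' x' = s \<longrightarrow> dist p' y' = t \<longrightarrow> d (\<gamma> s) (\<delta> t) \<le> dist x' y')))"

definition unit_cube :: "nat \<Rightarrow> (nat \<Rightarrow> real) set"
  where "unit_cube n = {..<n} \<rightarrow>\<^sub>E {0..1}"

definition cube_dist :: "nat \<Rightarrow> (nat \<Rightarrow> real) \<Rightarrow> (nat \<Rightarrow> real) \<Rightarrow> real"
  where "cube_dist n u v = L2_set (\<lambda>i. u i - v i) {..<n}"

definition is_face :: "nat \<Rightarrow> (nat \<Rightarrow> real) set \<Rightarrow> bool"
  where "is_face n T \<longleftrightarrow>
    (\<exists>A e. A \<subseteq> {..<n} \<and> (\<forall>i\<in>A. e i \<in> {0, 1}) \<and> T = {u \<in> unit_cube n. \<forall>i\<in>A. u i = e i})"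

definition cube_isometry ::
    "nat \<Rightarrow> (nat \<Rightarrow> real) set \<Rightarrow> nat \<Rightarrow> (nat \<Rightarrow> real) set \<Rightarrow> ((nat \<Rightarrow> real) \<Rightarrow> (nat \<Rightarrow> real)) \<Rightarrow> bool"
  where "cube_isometry n T n' T' h \<longleftrightarrow>
    bij_betw h T T' \<and> (\<forall>u\<in>T. \<forall>v\<in>T. cube_dist n' (h u) (h v) = cube_dist n u v)"

text \<open>
  A complex is given by its characteristic maps: a pair \<open>(n, \<sigma>)\<close> is an \<open>n\<close>-dimensional cube
  whose points are the \<open>\<sigma> u\<close> with \<open>u \<in> unit_cube n\<close>. Following Bridson and Haefliger, cubes are
  embedded and two cubes are disjoint or meet in exactly one common face. In addition, the faces
  of a cube are themselves listed as cubes. There is no bound on the dimensions of the cubes.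
\<close>

type_synonym 'a cubes = "(nat \<times> ((nat \<Rightarrow> real) \<Rightarrow> 'a)) set"

definition cubical_complex :: "'a cubes \<Rightarrow> bool"
  where "cubical_complex K \<longleftrightarrow>
    (\<forall>(n, \<sigma>)\<in>K. inj_on \<sigma> (unit_cube n)) \<and>
    (\<forall>(n, \<sigma>)\<in>K. \<forall>T. is_face n T \<longrightarrow> (\<exists>(n', \<sigma>')\<in>K. \<sigma>' ` unit_cube n' = \<sigma> ` T)) \<and>
    (\<forall>(n, \<sigma>)\<in>K. \<forall>(n', \<sigma>')\<in>K. \<sigma> ` unit_cube n \<inter> \<sigma>' ` unit_cube n' \<noteq> {} \<longrightarrow>
      (\<exists>T T' h. is_face n T \<and> is_face n' T' \<and> cube_isometry n T n' T' h \<and>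
        (\<forall>u\<in>unit_cube n. \<forall>u'\<in>unit_cube n'. \<sigma> u = \<sigma>' u' \<longleftrightarrow> u \<in> T \<and> u' = h u)))"

definition complex_points :: "'a cubes \<Rightarrow> 'a set"
  where "complex_points K = (\<Union>(n, \<sigma>)\<in>K. \<sigma> ` unit_cube n)"

text \<open>
  \<open>string_between K x y l\<close>: some finite sequence of points from \<open>x\<close> to \<open>y\<close>, with consecutive points
  in a common cube, has total length \<open>l\<close>. The infimum of these lengths is the intrinsic
  distance; it is meaningful only if \<open>x\<close> and \<open>y\<close> are joined by some string. Off the complex it
  is \<open>0\<close>, because \<open>Metric_space\<close> requires nonnegativity and symmetry on the whole type.
\<close>

inductive string_between :: "'a cubes \<Rightarrow> 'a \<Rightarrow> 'a \<Rightarrow> real \<Rightarrow> bool" for K x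
  where
    start: "x \<in> complex_points K \<Longrightarrow> string_between K x x 0"
  | step: "string_between K x (\<sigma> u) l \<Longrightarrow> (n, \<sigma>) \<in> K \<Longrightarrow> u \<in> unit_cube n \<Longrightarrow> v \<in> unit_cube n \<Longrightarrow>
      string_between K x (\<sigma> v) (l + cube_dist n u v)"

definition complex_dist :: "'a cubes \<Rightarrow> 'a \<Rightarrow> 'a \<Rightarrow> real"
  where "complex_dist K x y =
    (if x \<in> complex_points K \<and> y \<in> complex_points K then Inf {l. string_between K x y l} else 0)"

definition CAT0_cubical_complex :: "'a cubes \<Rightarrow> bool"
  where "CAT0_cubical_complex K \<longleftrightarrow> cubical_complex K \<and>
    (\<forall>x\<in>complex_points K. \<forall>y\<in>complex_points K. \<exists>l. string_between K x y l) \<and>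
    CAT0_space (complex_points K) (complex_dist K)"

definition cubical_automorphism :: "'a cubes \<Rightarrow> ('a \<Rightarrow> 'a) \<Rightarrow> bool"
  where "cubical_automorphism K f \<longleftrightarrow>
    bij_betw f (complex_points K) (complex_points K) \<and>
    (\<forall>(n, \<sigma>)\<in>K. \<exists>(n', \<sigma>')\<in>K. \<exists>h. cube_isometry n (unit_cube n) n' (unit_cube n') h \<and>
      (\<forall>u\<in>unit_cube n. f (\<sigma> u) = \<sigma>' (h u)))"

definition acts_cubically :: "('g, 'c) monoid_scheme \<Rightarrow> 'a cubes \<Rightarrow> ('g \<Rightarrow> 'a \<Rightarrow> 'a) \<Rightarrow> bool"
  where "acts_cubically G K \<rho> \<longleftrightarrow>
    group_action G (complex_points K) \<rho> \<and> (\<forall>g\<in>carrier G. cubical_automorphism K (\<rho> g))"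

definition has_fixed_point :: "('g, 'c) monoid_scheme \<Rightarrow> 'a set \<Rightarrow> ('g \<Rightarrow> 'a \<Rightarrow> 'a) \<Rightarrow> bool"
  where "has_fixed_point G X \<rho> \<longleftrightarrow> (\<exists>x\<in>X. \<forall>g\<in>carrier G. \<rho> g x = x)"

definition complex_ring :: "complex ring"
  where "complex_ring = \<lparr> carrier = UNIV, mult = (*), one = 1, zero = 0, add = (+) \<rparr>"

record 'h inner_module = "(complex, 'h) module" +
  ip :: "'h \<Rightarrow> 'h \<Rightarrow> complex"

definition hnorm :: "'h inner_module \<Rightarrow> 'h \<Rightarrow> real"
  where "hnorm H x = sqrt (Re (ip H x x))"

definition hdist :: "'h inner_module \<Rightarrow> 'h \<Rightarrow> 'h \<Rightarrow> real"
  where "hdist H x y =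
    (if x \<in> carrier H \<and> y \<in> carrier H then hnorm H (x \<ominus>\<^bsub>H\<^esub> y) else 0)"

definition complex_hilbert_space :: "'h inner_module \<Rightarrow> bool"
  where "complex_hilbert_space H \<longleftrightarrow>
    Module.module complex_ring H \<and>
    (\<forall>x\<in>carrier H. \<forall>y\<in>carrier H. \<forall>z\<in>carrier H. ip H (x \<oplus>\<^bsub>H\<^esub> y) z = ip H x z + ip H y z) \<and>
    (\<forall>c. \<forall>x\<in>carrier H. \<forall>y\<in>carrier H. ip H (c \<odot>\<^bsub>H\<^esub> x) y = c * ip H x y) \<and>
    (\<forall>x\<in>carrier H. \<forall>y\<in>carrier H. ip H y x = cnj (ip H x y)) \<and>
    (\<forall>x\<in>carrier H. x \<noteq> \<zero>\<^bsub>H\<^esub> \<longrightarrow> Re (ip H x x) > 0) \<and>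
    Metric_space.mcomplete (carrier H) (hdist H)"

definition unitary_representation ::
    "('g, 'c) monoid_scheme \<Rightarrow> 'h inner_module \<Rightarrow> ('g \<Rightarrow> 'h \<Rightarrow> 'h) \<Rightarrow> bool"
  where "unitary_representation G H \<pi> \<longleftrightarrow>
    complex_hilbert_space H \<and> group_action G (carrier H) \<pi> \<and>
    (\<forall>g\<in>carrier G. \<forall>x\<in>carrier H. \<forall>y\<in>carrier H.
      \<pi> g (x \<oplus>\<^bsub>H\<^esub> y) = \<pi> g x \<oplus>\<^bsub>H\<^esub> \<pi> g y \<and>
      (\<forall>c. \<pi> g (c \<odot>\<^bsub>H\<^esub> x) = c \<odot>\<^bsub>H\<^esub> \<pi> g x) \<and>
      ip H (\<pi> g x) (\<pi> g y) = ip H x y)"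

text \<open>
  The compact subsets of a discrete group are the finite ones. The definition cannot quantify
  over all types of vectors, but \<open>'g \<times> nat \<Rightarrow> complex\<close> is large enough. To see this, consider a
  representation with a \<open>(Q, \<epsilon>)\<close>-invariant vector and without nonzero invariant vectors. The closed
  linear span of the orbit of that vector is a subrepresentation with the same two properties; it
  has a dense subset of cardinality at most \<open>\<bar>'g \<times> nat\<bar>\<close>, so its cardinality is at most that of
  \<open>'g \<times> nat \<Rightarrow> complex\<close>.
\<close>

definition property_T :: "('g, 'c) monoid_scheme \<Rightarrow> bool"
  where "property_T G \<longleftrightarrow>
    (\<exists>Q \<epsilon>. Q \<subseteq> carrier G \<and> finite Q \<and> \<epsilon> > 0 \<and>
      (\<forall>(H :: ('g \<times> nat \<Rightarrow> complex) inner_module) \<pi>. unitary_representation G H \<pi> \<longrightarrow>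
        (\<exists>x\<in>carrier H. x \<noteq> \<zero>\<^bsub>H\<^esub> \<and> (\<forall>g\<in>Q. hdist H (\<pi> g x) x < \<epsilon> * hnorm H x)) \<longrightarrow>
        (\<exists>x\<in>carrier H. x \<noteq> \<zero>\<^bsub>H\<^esub> \<and> (\<forall>g\<in>carrier G. \<pi> g x = x))))"

end

theory Submission
  imports Defs
begin

text \<open>
  Let \<open>\<Gamma> = B(m, n)\<close> and let a word \<open>w\<close> trace its path in the Cayley graph of \<open>\<Gamma>\<close>. The number of signed
  crossings of each edge, taken modulo \<open>k\<close>, turns the set \<open>Y\<close> of pairs of an edge and an element of
  \<open>\<int>/k\<close> into a set on which the free group acts. The power \<open>w\<^sup>n\<close> traces a closed path, so its \<open>k\<close>-th
  power acts trivially and \<open>B(m, kn)\<close> acts on \<open>Y\<close>. The zero sheet \<open>Z \<subseteq> Y\<close> is moved by each element in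
  finitely many points only, but a geodesic word of length \<open>L\<close> moves at least \<open>L\<close> of them (here
  \<open>k > 1\<close> is used), and there are arbitrarily long geodesics because \<open>\<Gamma>\<close> is infinite.

  Such an action yields both claims. The points of \<open>[0,1]\<^sup>Y\<close> that differ from the indicator function of \<open>Z\<close> in
  finitely many coordinates form a cubical complex; it is convex in a Hilbert space, hence CAT(0), and any
  two of its points lie in a common cube. The group permutes the coordinates, and a fixed point that
  deviates from \<open>Z\<close> in \<open>N\<close> coordinates would bound all the displacements of \<open>Z\<close> by \<open>2N\<close>. For property (T),
  take in the plane two unit vectors with inner product \<open>r < 1\<close> for the two values of a coordinate.
  In the tensor product of these planes over \<open>Y\<close>, with the vector of \<open>Z\<close> as vacuum, the group acts
  unitarily, and the vacuum is moved to a vector with inner product \<open>r\<close> to the power \<open>d(g)\<close>, where \<open>d(g)\<close>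
  is the number of points in which \<open>g\<close> moves \<open>Z\<close>. For \<open>r\<close> close to \<open>1\<close> the vacuum is almost invariant,
  while all matrix coefficients decay with \<open>d(g)\<close>, so that no nonzero vector is invariant.
\<close>

section \<open>Commensurating actions\<close>

text \<open>Bijectivity need not be assumed, since \<open>inv g\<close> acts as the inverse of
  \<open>g\<close>. Extensionality is required because the elements of \<open>BijGroup E\<close> are
  extensional maps, multiplied by \<open>compose E\<close>.\<close>

lemma group_actionI:
  assumes "group G"
    and closed: "\<And>g x. g \<in> carrier G \<Longrightarrow> x \<in> E \<Longrightarrow> \<rho> g x \<in> E"
    and ext: "\<And>g. g \<in> carrier G \<Longrightarrow> \<rho> g \<in> extensional E"
    and one: "\<And>x. x \<in> E \<Longrightarrow> \<rho> \<one>\<^bsub>G\<^esub> x = x"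
    and mult: "\<And>g h x. g \<in> carrier G \<Longrightarrow> h \<in> carrier G \<Longrightarrow> x \<in> E \<Longrightarrow>
      \<rho> (g \<otimes>\<^bsub>G\<^esub> h) x = \<rho> g (\<rho> h x)"
  shows "group_action G E \<rho>"
proof -
  interpret G: group G by fact
  have Bij: "\<rho> g \<in> Bij E" if g: "g \<in> carrier G" for g
  proof -
    have i: "inv\<^bsub>G\<^esub> g \<in> carrier G" using g by simp
    have "bij_betw (\<rho> g) E E"
      by (rule bij_betw_byWitness[where f' = "\<rho> (inv\<^bsub>G\<^esub> g)"])
        (use g i in \<open>auto simp: mult[symmetric] one intro: closed\<close>)
    with ext[OF g] show ?thesis by (simp add: Bij_def)
  qed
  have "\<rho> (g \<otimes>\<^bsub>G\<^esub> h) = \<rho> g \<otimes>\<^bsub>BijGroup E\<^esub> \<rho> h"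
    if g: "g \<in> carrier G" and h: "h \<in> carrier G" for g h
  proof -
    have "\<rho> (g \<otimes>\<^bsub>G\<^esub> h) = compose E (\<rho> g) (\<rho> h)"
      by (rule extensionalityI[of _ E]) (use g h in \<open>auto simp: ext mult compose_def\<close>)
    then show ?thesis using Bij[OF g] Bij[OF h] by (simp add: BijGroup_def)
  qed
  then have "\<rho> \<in> hom G (BijGroup E)"
    using Bij by (auto simp: hom_def BijGroup_def)
  then show ?thesis
    by (simp add: group_action_def group_hom_def group_hom_axioms_def group_BijGroup \<open>group G\<close>)
qed

lemma (in group_action) action_mult:
  assumes "g \<in> carrier G" "h \<in> carrier G" "x \<in> E"
  shows "\<phi> (g \<otimes> h) x = \<phi> g (\<phi> h x)"
  using composition_rule[OF assms(3,1,2)] by simp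

lemma (in group_action) action_one:
  assumes "x \<in> E" shows "\<phi> \<one> x = x"
  using id_eq_one assms by (metis restrict_apply')

lemma (in group_action) action_inv:
  assumes "g \<in> carrier G" "x \<in> E"
  shows "\<phi> (inv g) (\<phi> g x) = x" "\<phi> g (\<phi> (inv g) x) = x"
proof -
  interpret group G using group_hom group_hom.axioms(1) by blast
  show "\<phi> (inv g) (\<phi> g x) = x" "\<phi> g (\<phi> (inv g) x) = x"
    using action_mult[of "inv g" g x] action_mult[of g "inv g" x] assms action_one by auto
qed

text \<open>The set \<open>B\<close> is commensurated: each group element moves it by a finite
  amount, but there is no common bound. Acting on the naturals keeps the points of the cube in the
  type \<open>nat \<Rightarrow> real\<close>.\<close>

locale commensurating_action = group_action G "UNIV :: nat set" \<phi> for G (structure) and \<phi> +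
  fixes B :: "nat set"
  assumes finite_defect: "g \<in> carrier G \<Longrightarrow> finite (sym_diff (\<phi> g ` B) B)"
    and unbounded_defect: "\<exists>g\<in>carrier G. N \<le> card (sym_diff (\<phi> g ` B) B)"
begin

sublocale G: group G
  using group_hom group_hom.axioms(1) by blast

lemma bij_action: "g \<in> carrier G \<Longrightarrow> bij (\<phi> g)"
  using bij_prop0 by (auto simp: Bij_def)

lemma act_mult: "g \<in> carrier G \<Longrightarrow> h \<in> carrier G \<Longrightarrow> \<phi> (g \<otimes> h) x = \<phi> g (\<phi> h x)"
  by (simp add: action_mult)

lemma act_one: "\<phi> \<one> x = x"
  by (simp add: action_one)

lemma act_inv: 
  assumes "g \<in> carrier G"
  shows "\<phi> (inv g) (\<phi> g x) = x" "\<phi> g (\<phi> (inv g) x) = x"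
  using assms by (simp_all add: action_inv)

lemma mem_image_action: "g \<in> carrier G \<Longrightarrow> x \<in> \<phi> g ` A \<longleftrightarrow> \<phi> (inv g) x \<in> A"
  by (metis act_inv image_iff)

end

lemma commensurating_action_transport:
  fixes Y :: "'y set"
  assumes act: "group_action G Y \<phi>" and Y: "countable Y" and B: "B \<subseteq> Y"
    and fin: "\<And>g. g \<in> carrier G \<Longrightarrow> finite (sym_diff (\<phi> g ` B) B)"
    and unb: "\<And>N. \<exists>g\<in>carrier G. N \<le> card (sym_diff (\<phi> g ` B) B)"
  obtains \<psi> B' where "commensurating_action G \<psi> B'"
proof -
  interpret A: group_action G Y \<phi> by fact
  interpret G: group G using A.group_hom group_hom.axioms(1) by blast
  define e where "e = to_nat_on Y"
  have e: "inj_on e Y" unfolding e_def using Y by (rule inj_on_to_nat_on)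
  define \<psi> where "\<psi> g j = (if j \<in> e ` Y then e (\<phi> g (inv_into Y e j)) else j)" for g j
  have closed: "\<phi> g y \<in> Y" if "g \<in> carrier G" "y \<in> Y" for g y
    using A.surj_prop[OF that(1)] that(2) by blast
  have \<psi>_e: "\<psi> g (e y) = e (\<phi> g y)" if "y \<in> Y" for g y
    using that e by (simp add: \<psi>_def)
  have \<psi>_out: "\<psi> g j = j" if "j \<notin> e ` Y" for g j
    using that by (simp add: \<psi>_def)
  have act': "group_action G UNIV \<psi>"
  proof (rule group_actionI)
    show "\<psi> \<one>\<^bsub>G\<^esub> j = j" for j
      by (cases "j \<in> e ` Y") (auto simp: \<psi>_e \<psi>_out A.action_one)
    show "\<psi> (g \<otimes>\<^bsub>G\<^esub> h) j = \<psi> g (\<psi> h j)" if "g \<in> carrier G" "h \<in> carrier G" for g h j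
      using that by (cases "j \<in> e ` Y") (auto simp: \<psi>_e \<psi>_out A.action_mult closed)
  qed (simp_all add: G.is_group)
  have d: "sym_diff (\<psi> g ` e ` B) (e ` B) = e ` sym_diff (\<phi> g ` B) B" if g: "g \<in> carrier G" for g
  proof -
    have sub: "\<phi> g ` B \<subseteq> Y" using closed[OF g] B by blast
    have "\<psi> g ` e ` B = e ` \<phi> g ` B" using B by (force simp: \<psi>_e image_image)
    moreover have "e ` (\<phi> g ` B - B) = e ` \<phi> g ` B - e ` B"
      by (rule inj_on_image_set_diff[OF e _ B]) (use sub in blast)
    moreover have "e ` (B - \<phi> g ` B) = e ` B - e ` \<phi> g ` B"
      by (rule inj_on_image_set_diff[OF e _ sub]) (use B in blast)
    ultimately show ?thesis by (simp only: image_Un)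
  qed
  have "inj_on e (sym_diff (\<phi> g ` B) B)" if "g \<in> carrier G" for g
    using e closed[OF that] B by (blast intro: inj_on_subset)
  then have unb': "\<exists>g\<in>carrier G. N \<le> card (sym_diff (\<psi> g ` e ` B) (e ` B))" for N
    using unb[of N] by (auto simp: d card_image)
  have fin': "finite (sym_diff (\<psi> g ` e ` B) (e ` B))" if "g \<in> carrier G" for g
    unfolding d[OF that] using fin[OF that] by (rule finite_imageI)
  show thesis
    by (rule that, intro commensurating_action.intro commensurating_action_axioms.intro)
      (fact act' fin' unb')+
qed

section \<open>The cube of finite deviations from a set\<close>

definition cube_points :: "nat set \<Rightarrow> (nat \<Rightarrow> real) set"
  where "cube_points B = {x. (\<forall>j. x j \<in> {0..1}) \<and> finite {j. x j \<noteq> indicator B j}}"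

definition cube_vertices :: "nat set \<Rightarrow> (nat \<Rightarrow> real) set"
  where "cube_vertices B = {x \<in> cube_points B. \<forall>j. x j \<in> {0, 1}}"

text \<open>A face of the infinite cube: the coordinates \<open>q 0, ..., q (n - 1)\<close> vary
  freely, all others are frozen to their values at the vertex \<open>v\<close>.\<close>

definition chart :: "nat \<Rightarrow> (nat \<Rightarrow> nat) \<Rightarrow> (nat \<Rightarrow> real) \<Rightarrow> (nat \<Rightarrow> real) \<Rightarrow> nat \<Rightarrow> real"
  where "chart n q v u = (\<lambda>j. if j \<in> q ` {..<n} then u (inv_into {..<n} q j) else v j)"

text \<open>A face is listed with every numbering \<open>q\<close> of its free coordinates, so that
  permuting the coordinates by a group element sends listed charts to listed charts.\<close>

definition cube_cubes :: "nat set \<Rightarrow> (nat \<Rightarrow> real) cubes"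
  where "cube_cubes B = {(n, chart n q v) | n q v. inj_on q {..<n} \<and> v \<in> cube_vertices B}"

definition finite_dist :: "(nat \<Rightarrow> real) \<Rightarrow> (nat \<Rightarrow> real) \<Rightarrow> real"
  where "finite_dist x y = L2_set (\<lambda>j. x j - y j) {j. x j \<noteq> y j}"

text \<open>The additional coordinates contribute zero, so several distances can be computed over
  one common finite set.\<close>

lemma finite_dist_eq:
  assumes "finite F" "{j. x j \<noteq> y j} \<subseteq> F"
  shows "finite_dist x y = L2_set (\<lambda>j. x j - y j) F"
  unfolding finite_dist_def L2_set_def
  by (intro arg_cong[where f = sqrt] sum.mono_neutral_left) (use assms in auto)

lemma chart_image: "inj_on q {..<n} \<Longrightarrow> i < n \<Longrightarrow> chart n q v u (q i) = u i"
  by (simp add: chart_def)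

lemma chart_outside: "j \<notin> q ` {..<n} \<Longrightarrow> chart n q v u j = v j"
  by (simp add: chart_def)

lemma chart_inj: 
  assumes "inj_on q {..<n}"
  shows "inj_on (chart n q v) (unit_cube n)"
proof (rule inj_onI)
  fix u u' assume u: "u \<in> unit_cube n" "u' \<in> unit_cube n" and e: "chart n q v u = chart n q v u'"
  show "u = u'"
  proof (rule extensionalityI[of _ "{..<n}"])
    show "u i = u' i" if "i \<in> {..<n}" for i
      using e chart_image[OF assms, of i v] that by (metis lessThan_iff)
  qed (use u in \<open>auto simp: unit_cube_def PiE_def\<close>)
qed

lemma chart_dist:
  assumes q: "inj_on q {..<n}"
  shows "finite_dist (chart n q v u) (chart n q v u') = cube_dist n u u'"
proof -
  have "finite_dist (chart n q v u) (chart n q v u') =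
      L2_set (\<lambda>j. chart n q v u j - chart n q v u' j) (q ` {..<n})"
    by (rule finite_dist_eq) (auto simp: chart_def)
  also have "\<dots> = cube_dist n u u'"
    unfolding L2_set_def cube_dist_def
    by (simp add: sum.reindex[OF q] chart_image[OF q])
  finally show ?thesis .
qed

lemma chart_points:
  assumes "inj_on q {..<n}" "v \<in> cube_vertices B" "u \<in> unit_cube n"
  shows "chart n q v u \<in> cube_points B"
proof -
  have "finite ({j. v j \<noteq> indicator B j} \<union> q ` {..<n})"
    using assms by (simp add: cube_vertices_def cube_points_def)
  then have "finite {j. chart n q v u j \<noteq> indicator B j}"
    by (rule finite_subset[rotated]) (auto simp: chart_def)
  moreover have "chart n q v u j \<in> {0..1}" for j
  proof (cases "j \<in> q ` {..<n}")
    case True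
    then obtain i where "i < n" "j = q i" by auto
    then show ?thesis using assms chart_image[of q n i v u] by (force simp: unit_cube_def PiE_def)
  next
    case False
    then show ?thesis using assms by (simp add: chart_outside cube_vertices_def cube_points_def)
  qed
  ultimately show ?thesis by (simp add: cube_points_def)
qed

lemma chart_surj:
  assumes q: "inj_on q {..<n}" and x: "x \<in> cube_points B"
    and v: "\<And>j. j \<notin> q ` {..<n} \<Longrightarrow> x j = v j"
  shows "(\<lambda>i\<in>{..<n}. x (q i)) \<in> unit_cube n" "chart n q v (\<lambda>i\<in>{..<n}. x (q i)) = x"
proof -
  show "(\<lambda>i\<in>{..<n}. x (q i)) \<in> unit_cube n"
    using x by (auto simp: unit_cube_def cube_points_def)
  show "chart n q v (\<lambda>i\<in>{..<n}. x (q i)) = x"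
  proof
    fix j show "chart n q v (\<lambda>i\<in>{..<n}. x (q i)) j = x j"
      by (cases "j \<in> q ` {..<n}") (auto simp: chart_image[OF q] chart_outside v)
  qed
qed

lemma chart_range:
  assumes q: "inj_on q {..<n}" and v: "v \<in> cube_vertices B"
  shows "chart n q v ` unit_cube n = {x \<in> cube_points B. \<forall>j. j \<notin> q ` {..<n} \<longrightarrow> x j = v j}"
proof (intro equalityI subsetI)
  fix x assume "x \<in> chart n q v ` unit_cube n"
  then show "x \<in> {x \<in> cube_points B. \<forall>j. j \<notin> q ` {..<n} \<longrightarrow> x j = v j}"
    using chart_points[OF q v] by (auto simp: chart_outside)
next
  fix x assume "x \<in> {x \<in> cube_points B. \<forall>j. j \<notin> q ` {..<n} \<longrightarrow> x j = v j}"
  then have x: "x \<in> cube_points B" "\<And>j. j \<notin> q ` {..<n} \<Longrightarrow> x j = v j" by auto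
  show "x \<in> chart n q v ` unit_cube n"
    using chart_surj[OF q x(1), of v] x(2) by (intro image_eqI[of _ _ "\<lambda>i\<in>{..<n}. x (q i)"]) auto
qed

lemma base_vertex: "indicator B \<in> cube_vertices B"
  by (auto simp: cube_vertices_def cube_points_def indicator_def)

lemma finite_differ:
  assumes "x \<in> cube_points B" "y \<in> cube_points B"
  shows "finite {j. x j \<noteq> y j}"
proof -
  have "finite ({j. x j \<noteq> indicator B j} \<union> {j. y j \<noteq> indicator B j})"
    using assms by (simp add: cube_points_def)
  then show ?thesis by (rule finite_subset[rotated]) auto
qed

text \<open>Only finitely many coordinates of \<open>x\<close> and \<open>y\<close> deviate from
  \<open>B\<close>. Freeing exactly these and freezing the rest at the vertex of \<open>B\<close>
  gives a finite-dimensional cube through both points.\<close>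

lemma common_chart:
  assumes x: "x \<in> cube_points B" and y: "y \<in> cube_points B"
  obtains n q v u u' where "inj_on q {..<n}" "v \<in> cube_vertices B"
    "u \<in> unit_cube n" "u' \<in> unit_cube n" "chart n q v u = x" "chart n q v u' = y"
proof -
  define F where "F = {j. x j \<noteq> indicator B j} \<union> {j. y j \<noteq> indicator B j}"
  have "finite F" using x y by (simp add: F_def cube_points_def)
  then obtain q where q: "bij_betw q {..<card F} F"
    using ex_bij_betw_nat_finite[of F] by (auto simp: atLeast0LessThan)
  then have inj: "inj_on q {..<card F}" and im: "q ` {..<card F} = F"
    by (auto simp: bij_betw_def)
  have "x j = indicator B j" "y j = indicator B j" if "j \<notin> q ` {..<card F}" for j
    using that unfolding im by (auto simp: F_def)
  then show thesis
    using chart_surj[OF inj x, of "indicator B"] chart_surj[OF inj y, of "indicator B"]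
    by (intro that[OF inj base_vertex]) auto
qed

lemma complex_points_cube: "complex_points (cube_cubes B) = cube_points B"
proof (intro equalityI subsetI)
  fix x assume "x \<in> cube_points B"
  then obtain n q v u u' where "inj_on q {..<n}" "v \<in> cube_vertices B"
    "u \<in> unit_cube n" "chart n q v u = x" using common_chart[of x B x] by metis
  then show "x \<in> complex_points (cube_cubes B)"
    unfolding complex_points_def cube_cubes_def by blast
qed (auto simp: complex_points_def cube_cubes_def chart_points)

section \<open>The intrinsic metric of the cube\<close>

lemma finite_dist_triangle:
  assumes "x \<in> cube_points B" "y \<in> cube_points B" "z \<in> cube_points B"
  shows "finite_dist x z \<le> finite_dist x y + finite_dist y z"
proof -
  define F where "F = {j. x j \<noteq> y j} \<union> {j. y j \<noteq> z j}"
  have F: "finite F" using assms finite_differ by (simp add: F_def)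
  have "L2_set (\<lambda>j. x j - z j) F = L2_set (\<lambda>j. (x j - y j) + (y j - z j)) F" by simp
  also have "\<dots> \<le> L2_set (\<lambda>j. x j - y j) F + L2_set (\<lambda>j. y j - z j) F"
    by (rule L2_set_triangle_ineq)
  finally show ?thesis
    by (subst (1 2 3) finite_dist_eq[OF F]) (auto simp: F_def)
qed

text \<open>Each step of a string stays in one cube, where the chart is an isometry for
  \<open>finite_dist\<close>. The triangle inequality then shows that no string is shorter than the
  straight distance.\<close>

lemma string_between_finite_dist:
  assumes "string_between (cube_cubes B) x y l"
  shows "y \<in> cube_points B \<and> x \<in> cube_points B \<and> finite_dist x y \<le> l"
  using assms
proof induction
  case start
  then show ?case by (simp add: complex_points_cube finite_dist_def)
next
  case (step \<sigma> u l n v)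
  from \<open>(n, \<sigma>) \<in> cube_cubes B\<close> obtain q w where q: "inj_on q {..<n}" and w: "w \<in> cube_vertices B"
    and \<sigma>: "\<sigma> = chart n q w" by (auto simp: cube_cubes_def)
  have "\<sigma> v \<in> cube_points B" using q w step by (simp add: \<sigma> chart_points)
  moreover from this have "finite_dist x (\<sigma> v) \<le> finite_dist x (\<sigma> u) + finite_dist (\<sigma> u) (\<sigma> v)"
    using step by (intro finite_dist_triangle) auto
  ultimately show ?case using step chart_dist[OF q] by (fastforce simp: \<sigma>)
qed

text \<open>A single step inside a common cube attains the lower bound, so the infimum that defines
  the intrinsic distance is a minimum.\<close>

lemma string_between_ex:
  assumes "x \<in> cube_points B" "y \<in> cube_points B"
  shows "string_between (cube_cubes B) x y (finite_dist x y)"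
proof -
  obtain n q v u u' where c: "inj_on q {..<n}" "v \<in> cube_vertices B"
    "u \<in> unit_cube n" "u' \<in> unit_cube n" "chart n q v u = x" "chart n q v u' = y"
    using common_chart[OF assms] .
  have "string_between (cube_cubes B) x (chart n q v u) 0"
    using c assms string_between.start[of x] complex_points_cube by simp
  moreover have "(n, chart n q v) \<in> cube_cubes B" using c by (auto simp: cube_cubes_def)
  ultimately have "string_between (cube_cubes B) x (chart n q v u') (0 + cube_dist n u u')"
    using c(3,4) by (rule string_between.step)
  then show ?thesis using c chart_dist[OF c(1), of v u u'] by simp
qed

lemma complex_dist_cube:
  assumes "x \<in> cube_points B" "y \<in> cube_points B"
  shows "complex_dist (cube_cubes B) x y = finite_dist x y"
  using assms string_between_ex[OF assms] string_between_finite_dist[of B x y]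
  unfolding complex_dist_def complex_points_cube
  by (auto intro!: cInf_eq_minimum)

text \<open>Lying in the second cube constrains exactly those free coordinates of the first that are
  frozen in the second. They are forced to coordinates of the vertex \<open>v'\<close>, which are 0
  or 1, and this cuts out a face.\<close>

lemma is_face_preimage:
  assumes q: "inj_on q {..<n}" and v: "v \<in> cube_vertices B"
    and q': "inj_on q' {..<n'}" and v': "v' \<in> cube_vertices B"
    and ne: "chart n q v ` unit_cube n \<inter> chart n' q' v' ` unit_cube n' \<noteq> {}"
  shows "is_face n {u \<in> unit_cube n. chart n q v u \<in> chart n' q' v' ` unit_cube n'}"
proof -
  define A where "A = {i. i < n \<and> q i \<notin> q' ` {..<n'}}"
  have vv: "v j = v' j" if "j \<notin> q ` {..<n}" "j \<notin> q' ` {..<n'}" for j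
  proof -
    from ne obtain u u' where "chart n q v u = chart n' q' v' u'" by blast
    then show ?thesis using that by (metis chart_outside)
  qed
  have "chart n q v u \<in> chart n' q' v' ` unit_cube n' \<longleftrightarrow> (\<forall>i\<in>A. u i = v' (q i))"
    if u: "u \<in> unit_cube n" for u
  proof -
    have "chart n q v u \<in> chart n' q' v' ` unit_cube n' \<longleftrightarrow>
        (\<forall>j. j \<notin> q' ` {..<n'} \<longrightarrow> chart n q v u j = v' j)"
      using chart_range[OF q' v'] chart_points[OF q v u] by auto
    also have "\<dots> \<longleftrightarrow> (\<forall>i\<in>A. u i = v' (q i))"
    proof (intro iffI allI ballI impI)
      fix j assume a: "\<forall>i\<in>A. u i = v' (q i)" and j: "j \<notin> q' ` {..<n'}"
      show "chart n q v u j = v' j"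
      proof (cases "j \<in> q ` {..<n}")
        case True
        then obtain i where "i < n" "j = q i" by auto
        then show ?thesis using a j chart_image[OF q] by (simp add: A_def)
      qed (use vv j in \<open>simp add: chart_outside\<close>)
    next
      fix i assume "\<forall>j. j \<notin> q' ` {..<n'} \<longrightarrow> chart n q v u j = v' j" "i \<in> A"
      then show "u i = v' (q i)" using chart_image[OF q] by (auto simp: A_def)
    qed
    finally show ?thesis .
  qed
  then have "{u \<in> unit_cube n. chart n q v u \<in> chart n' q' v' ` unit_cube n'} =
      {u \<in> unit_cube n. \<forall>i\<in>A. u i = v' (q i)}" by auto
  moreover have "A \<subseteq> {..<n}" "\<forall>i\<in>A. v' (q i) \<in> {0, 1}"
    using v' by (auto simp: A_def cube_vertices_def)
  ultimately show ?thesis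
    unfolding is_face_def by (intro exI[of _ A] exI[of _ "\<lambda>i. v' (q i)"]) auto
qed

lemma face_chart:
  assumes q: "inj_on q {..<n}" and v: "v \<in> cube_vertices B" and T: "is_face n T"
  obtains n' q' v' where "inj_on q' {..<n'}" "v' \<in> cube_vertices B"
    "chart n' q' v' ` unit_cube n' = chart n q v ` T"
proof -
  from T obtain A e where A: "A \<subseteq> {..<n}" and e: "\<forall>i\<in>A. e i \<in> {0, 1}"
    and T: "T = {u \<in> unit_cube n. \<forall>i\<in>A. u i = e i}" by (auto simp: is_face_def)
  define D where "D = {..<n} - A"
  have "finite D" by (simp add: D_def)
  then obtain p where p: "bij_betw p {..<card D} D"
    using ex_bij_betw_nat_finite[of D] by (auto simp: atLeast0LessThan)
  \<comment> \<open>On the coordinates that stay free the value 0 is an arbitrary choice that makes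
    \<open>v'\<close> a vertex.\<close>
  define u0 where "u0 = (\<lambda>i\<in>{..<n}. if i \<in> A then e i else 0)"
  define v' where "v' = chart n q v u0"
  have u0: "u0 \<in> unit_cube n" using e by (fastforce simp: u0_def unit_cube_def)
  have "inv_into {..<n} q j \<in> {..<n}" if "j \<in> q ` {..<n}" for j
    using that by (rule inv_into_into)
  then have "v' j \<in> {0, 1}" for j
    using v e by (auto simp: v'_def chart_def u0_def cube_vertices_def)
  then have v': "v' \<in> cube_vertices B"
    using chart_points[OF q v u0] by (simp add: cube_vertices_def v'_def)
  have D: "D \<subseteq> {..<n}" by (auto simp: D_def)
  have inj: "inj_on (q \<circ> p) {..<card D}"
    using p q inj_on_subset[OF q D] by (auto simp: bij_betw_def intro!: comp_inj_on)
  have im: "(q \<circ> p) ` {..<card D} = q ` D"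
    using p by (metis bij_betw_def image_comp)
  have "{x \<in> cube_points B. \<forall>j. j \<notin> q ` D \<longrightarrow> x j = v' j} = chart n q v ` T"
  proof (intro equalityI subsetI)
    fix x assume x: "x \<in> {x \<in> cube_points B. \<forall>j. j \<notin> q ` D \<longrightarrow> x j = v' j}"
    have "x \<in> chart n q v ` unit_cube n"
      using x D by (auto simp: chart_range[OF q v] v'_def chart_outside image_iff subset_iff)
    then obtain u where u: "u \<in> unit_cube n" "x = chart n q v u" by auto
    have "u i = e i" if i: "i \<in> A" for i
    proof -
      have "q i \<notin> q ` D" using i A D q by (auto simp: D_def inj_on_def)
      then have "x (q i) = v' (q i)" using x by auto
      moreover have "i < n" using i A by auto
      ultimately show ?thesis
        using i by (simp add: u v'_def chart_image[OF q]) (simp add: u0_def)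
    qed
    then show "x \<in> chart n q v ` T" using u by (auto simp: T)
  next
    fix x assume "x \<in> chart n q v ` T"
    then obtain u where u: "u \<in> unit_cube n" "\<forall>i\<in>A. u i = e i" "x = chart n q v u" by (auto simp: T)
    have "x j = v' j" if j: "j \<notin> q ` D" for j
    proof (cases "j \<in> q ` {..<n}")
      case True
      then obtain i where "i < n" "j = q i" by auto
      moreover from this j have "i \<in> A" by (auto simp: D_def)
      ultimately show ?thesis using u by (simp add: v'_def chart_image[OF q]) (simp add: u0_def)
    qed (simp add: u v'_def chart_outside)
    then show "x \<in> {x \<in> cube_points B. \<forall>j. j \<notin> q ` D \<longrightarrow> x j = v' j}"
      using chart_points[OF q v u(1)] by (simp add: u(3))
  qed
  then have "chart (card D) (q \<circ> p) v' ` unit_cube (card D) = chart n q v ` T"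
    by (simp only: chart_range[OF inj v'] im)
  with inj v' show thesis by (rule that)
qed

lemma cubical_complex_cube: "cubical_complex (cube_cubes B)"
proof -
  have 1: "inj_on \<sigma> (unit_cube n)" if "(n, \<sigma>) \<in> cube_cubes B" for n \<sigma>
    using that by (auto simp: cube_cubes_def chart_inj)
  have 2: "\<exists>(n', \<sigma>')\<in>cube_cubes B. \<sigma>' ` unit_cube n' = \<sigma> ` T"
    if s: "(n, \<sigma>) \<in> cube_cubes B" and T: "is_face n T" for n \<sigma> T
  proof -
    from s obtain q v where q: "inj_on q {..<n}" and v: "v \<in> cube_vertices B"
      and \<sigma>: "\<sigma> = chart n q v" by (auto simp: cube_cubes_def)
    obtain n' q' v' where "inj_on q' {..<n'}" "v' \<in> cube_vertices B"
      "chart n' q' v' ` unit_cube n' = chart n q v ` T" using face_chart[OF q v T] .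
    then show ?thesis unfolding cube_cubes_def \<sigma> by blast
  qed
  have 3: "\<exists>T T' h. is_face n T \<and> is_face n' T' \<and> cube_isometry n T n' T' h \<and>
        (\<forall>u\<in>unit_cube n. \<forall>u'\<in>unit_cube n'. \<sigma> u = \<sigma>' u' \<longleftrightarrow> u \<in> T \<and> u' = h u)"
    if s: "(n, \<sigma>) \<in> cube_cubes B" "(n', \<sigma>') \<in> cube_cubes B"
      and ne: "\<sigma> ` unit_cube n \<inter> \<sigma>' ` unit_cube n' \<noteq> {}" for n \<sigma> n' \<sigma>'
  proof -
    from s obtain q v q' v' where q: "inj_on q {..<n}" and v: "v \<in> cube_vertices B"
      and \<sigma>: "\<sigma> = chart n q v" and q': "inj_on q' {..<n'}" and v': "v' \<in> cube_vertices B"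
      and \<sigma>': "\<sigma>' = chart n' q' v'" by (auto simp: cube_cubes_def)
    define T where "T = {u \<in> unit_cube n. \<sigma> u \<in> \<sigma>' ` unit_cube n'}"
    define T' where "T' = {u \<in> unit_cube n'. \<sigma>' u \<in> \<sigma> ` unit_cube n}"
    define h where "h u = inv_into (unit_cube n') \<sigma>' (\<sigma> u)" for u
    note inj = 1[OF s(1)] 1[OF s(2)]
    have h: "h u \<in> unit_cube n'" "\<sigma>' (h u) = \<sigma> u" if "u \<in> T" for u
      using that by (auto simp: T_def h_def f_inv_into_f inv_into_into)
    have iff: "\<sigma> u = \<sigma>' u' \<longleftrightarrow> u \<in> T \<and> u' = h u" if u: "u \<in> unit_cube n" "u' \<in> unit_cube n'" for u u'
    proof
      assume e: "\<sigma> u = \<sigma>' u'"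
      then have "u \<in> T" using u by (simp add: T_def)
      moreover from this have "u' = h u" using h[of u] e u by (metis inj_onD[OF inj(2)])
      ultimately show "u \<in> T \<and> u' = h u" by simp
    qed (use h in auto)
    have "bij_betw h T T'"
    proof (rule bij_betw_imageI)
      show "inj_on h T"
      proof (rule inj_onI)
        fix u w assume u: "u \<in> T" "w \<in> T" "h u = h w"
        then have "\<sigma> u = \<sigma> w" using h(2) by metis
        then show "u = w" using u inj(1) by (auto simp: T_def dest: inj_onD)
      qed
      show "h ` T = T'"
      proof (intro equalityI subsetI)
        fix u' assume "u' \<in> T'"
        then obtain u where "u \<in> unit_cube n" "\<sigma> u = \<sigma>' u'" "u' \<in> unit_cube n'"
          by (auto simp: T'_def)
        then show "u' \<in> h ` T" using iff by blast
      next
        fix u' assume "u' \<in> h ` T"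
        then obtain u where "u \<in> T" "u' = h u" by auto
        then show "u' \<in> T'" using h[of u] by (auto simp: T'_def T_def)
      qed
    qed
    moreover have "cube_dist n' (h u) (h w) = cube_dist n u w" if "u \<in> T" "w \<in> T" for u w
      using h(2)[OF that(1)] h(2)[OF that(2)] chart_dist[OF q, of v u w]
        chart_dist[OF q', of v' "h u" "h w"] by (simp add: \<sigma> \<sigma>')
    ultimately have "cube_isometry n T n' T' h" by (simp add: cube_isometry_def)
    moreover have "is_face n T"
      using is_face_preimage[OF q v q' v'] ne by (simp add: \<sigma> \<sigma>' T_def)
    moreover have "is_face n' T'"
      using is_face_preimage[OF q' v' q v] ne by (simp add: \<sigma> \<sigma>' T'_def Int_commute)
    ultimately show ?thesis using iff by blast
  qed
  show ?thesis
    unfolding cubical_complex_def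
  proof (intro conjI ballI)
    fix c assume c: "c \<in> cube_cubes B"
    obtain n \<sigma> where [simp]: "c = (n, \<sigma>)" by (cases c)
    show "case c of (n, \<sigma>) \<Rightarrow> inj_on \<sigma> (unit_cube n)" using 1 c by simp
    show "case c of (n, \<sigma>) \<Rightarrow> \<forall>T. is_face n T \<longrightarrow>
        (\<exists>(n', \<sigma>')\<in>cube_cubes B. \<sigma>' ` unit_cube n' = \<sigma> ` T)"
      using 2 c by simp
    show "case c of (n, \<sigma>) \<Rightarrow> \<forall>(n', \<sigma>')\<in>cube_cubes B. \<sigma> ` unit_cube n \<inter> \<sigma>' ` unit_cube n' \<noteq> {} \<longrightarrow>
        (\<exists>T T' h. is_face n T \<and> is_face n' T' \<and> cube_isometry n T n' T' h \<and>
          (\<forall>u\<in>unit_cube n. \<forall>u'\<in>unit_cube n'. \<sigma> u = \<sigma>' u' \<longleftrightarrow> u \<in> T \<and> u' = h u))"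
    proof (unfold \<open>c = (n, \<sigma>)\<close> prod.case, intro ballI)
      fix c' assume c': "c' \<in> cube_cubes B"
      obtain n' \<sigma>' where "c' = (n', \<sigma>')" by (cases c')
      with 3 c c' show "case c' of (n', \<sigma>') \<Rightarrow> \<sigma> ` unit_cube n \<inter> \<sigma>' ` unit_cube n' \<noteq> {} \<longrightarrow>
          (\<exists>T T' h. is_face n T \<and> is_face n' T' \<and> cube_isometry n T n' T' h \<and>
            (\<forall>u\<in>unit_cube n. \<forall>u'\<in>unit_cube n'. \<sigma> u = \<sigma>' u' \<longleftrightarrow> u \<in> T \<and> u' = h u))"
        by simp
    qed
  qed
qed

section \<open>The cube is CAT(0)\<close>

text \<open>Stewart's theorem on the line. It is linear in the squared distances, so summing over
  coordinates yields it in every Euclidean space.\<close>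

lemma Stewart_identity:
  fixes a :: real
  shows "(z - ((1 - a) * x + a * y))\<^sup>2 = (1 - a) * (z - x)\<^sup>2 + a * (z - y)\<^sup>2 - a * (1 - a) * (x - y)\<^sup>2"
  by (simp add: power2_eq_square algebra_simps)

lemma Stewart_cube:
  assumes "x \<in> cube_points B" "y \<in> cube_points B" "z \<in> cube_points B"
  shows "(finite_dist z (\<lambda>j. (1 - a) * x j + a * y j))\<^sup>2 =
    (1 - a) * (finite_dist z x)\<^sup>2 + a * (finite_dist z y)\<^sup>2 - a * (1 - a) * (finite_dist x y)\<^sup>2"
proof -
  define F where "F = {j. z j \<noteq> x j} \<union> {j. z j \<noteq> y j}"
  have F: "finite F" using assms finite_differ by (simp add: F_def)
  have d: "(finite_dist w w')\<^sup>2 = (\<Sum>j\<in>F. (w j - w' j)\<^sup>2)" if "{j. w j \<noteq> w' j} \<subseteq> F" for w w'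
    unfolding finite_dist_eq[OF F that] L2_set_def by (simp add: sum_nonneg)
  \<comment> \<open>Outside \<open>F\<close> the three points agree, and by this rule the convex
    combination agrees with them too, so \<open>F\<close> suffices for all four distances.\<close>
  have [simp]: "(1 - a) * t + a * t = t" for t :: real by (simp add: algebra_simps)
  show ?thesis
    by (subst (1 2 3 4) d)
      (auto simp: F_def Stewart_identity sum.distrib sum_subtractf sum_distrib_left)
qed

lemma Stewart_plane:
  fixes x y z :: "real^2"
  shows "(dist z ((1 - a) *\<^sub>R x + a *\<^sub>R y))\<^sup>2 =
    (1 - a) * (dist z x)\<^sup>2 + a * (dist z y)\<^sup>2 - a * (1 - a) * (dist x y)\<^sup>2"
  unfolding dist_norm power2_norm_eq_inner
  by (simp add: inner_diff_left inner_diff_right inner_add_left inner_add_right inner_commute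
      algebra_simps)

lemma convex_comb_points:
  assumes x: "x \<in> cube_points B" and y: "y \<in> cube_points B" and a: "0 \<le> a" "a \<le> 1"
  shows "(\<lambda>j. (1 - a) * x j + a * y j) \<in> cube_points B"
proof -
  have "finite ({j. x j \<noteq> indicator B j} \<union> {j. y j \<noteq> indicator B j})"
    using x y by (simp add: cube_points_def)
  moreover have "(1 - a) * t + a * t = t" for t :: real by (simp add: algebra_simps)
  ultimately have "finite {j. (1 - a) * x j + a * y j \<noteq> indicator B j}"
    by (elim finite_subset[rotated]) auto
  moreover have "(1 - a) * x j + a * y j \<in> {0..1}" for j
  proof -
    have j: "0 \<le> x j" "x j \<le> 1" "0 \<le> y j" "y j \<le> 1" using x y by (auto simp: cube_points_def)
    then have "(1 - a) * x j + a * y j \<le> (1 - a) * 1 + a * 1"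
      using a by (intro add_mono mult_left_mono) auto
    then show ?thesis using a j by auto
  qed
  ultimately show ?thesis by (simp add: cube_points_def)
qed

lemma finite_dist_zero_iff:
  assumes "x \<in> cube_points B" "y \<in> cube_points B"
  shows "finite_dist x y = 0 \<longleftrightarrow> x = y"
  using finite_differ[OF assms] by (auto simp: finite_dist_def L2_set_eq_0_iff)

lemma finite_dist_commute: "finite_dist x y = finite_dist y x"
  unfolding finite_dist_def L2_set_def by (simp add: power2_commute eq_commute)

lemma finite_dist_nonneg: "0 \<le> finite_dist x y"
  by (simp add: finite_dist_def)

lemma Metric_space_cube: "Metric_space (cube_points B) (complex_dist (cube_cubes B))"
proof
  fix x y
  show "0 \<le> complex_dist (cube_cubes B) x y"
    using complex_dist_cube[of x B y] finite_dist_nonneg[of x y]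
    by (cases "x \<in> cube_points B \<and> y \<in> cube_points B") (auto simp: complex_dist_def complex_points_cube)
  show "complex_dist (cube_cubes B) x y = complex_dist (cube_cubes B) y x"
    using complex_dist_cube[of x B y] complex_dist_cube[of y B x] finite_dist_commute[of x y]
    by (cases "x \<in> cube_points B \<and> y \<in> cube_points B") (auto simp: complex_dist_def complex_points_cube)
qed (simp_all add: complex_dist_cube finite_dist_zero_iff finite_dist_triangle)

text \<open>Two points of the cube determine the point of given distances to them, so that geodesics are
  straight.\<close>

lemma geodesic_straight:
  assumes g: "geodesic_from_to (cube_points B) (complex_dist (cube_cubes B)) \<gamma> x y"
    and x: "x \<in> cube_points B" and y: "y \<in> cube_points B" and s: "s \<in> {0..finite_dist x y}"
  shows "\<gamma> s = (\<lambda>j. (1 - s / finite_dist x y) * x j + s / finite_dist x y * y j)"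
proof -
  define d where "d = finite_dist x y"
  \<comment> \<open>If \<open>d = 0\<close>, then \<open>s = 0\<close> and division by zero gives
    \<open>a = 0\<close>, so \<open>a * d = s\<close> holds in that case as well.\<close>
  define a where "a = s / d"
  have D: "complex_dist (cube_cubes B) x y = d" using x y by (simp add: complex_dist_cube d_def)
  have s': "0 \<le> s" "s \<le> d" using s by (auto simp: d_def)
  have a: "0 \<le> a" "a \<le> 1" "a * d = s" using s' by (auto simp: a_def divide_simps)
  have z: "\<gamma> s \<in> cube_points B" using g s' by (auto simp: geodesic_from_to_def D)
  have "complex_dist (cube_cubes B) (\<gamma> s) (\<gamma> 0) = \<bar>s - 0\<bar>"
    and "complex_dist (cube_cubes B) (\<gamma> s) (\<gamma> d) = \<bar>s - d\<bar>"
    and e: "\<gamma> 0 = x" "\<gamma> d = y"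
    using g s' unfolding geodesic_from_to_def D by auto
  then have "finite_dist (\<gamma> s) x = a * d" "finite_dist (\<gamma> s) y = (1 - a) * d"
    using s' x y z a(3) by (auto simp: complex_dist_cube left_diff_distrib)
  \<comment> \<open>With the distances \<open>a * d\<close> and \<open>(1 - a) * d\<close> to the
    endpoints, Stewart's formula puts \<open>\<gamma> s\<close> at distance zero from the convex
    combination.\<close>
  then have "(finite_dist (\<gamma> s) (\<lambda>j. (1 - a) * x j + a * y j))\<^sup>2 =
      (1 - a) * (a * d)\<^sup>2 + a * ((1 - a) * d)\<^sup>2 - a * (1 - a) * d\<^sup>2"
    by (simp add: Stewart_cube[OF x y z] d_def)
  also have "\<dots> = 0" by (simp add: power2_eq_square algebra_simps)
  finally show ?thesis
    using finite_dist_zero_iff[OF z convex_comb_points[OF x y a(1,2)]]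
    by (simp add: a_def d_def)
qed

lemma L2_set_scale: "L2_set (\<lambda>j. c * f j) F = \<bar>c\<bar> * L2_set f F"
  by (simp add: L2_set_def power_mult_distrib sum_distrib_left[symmetric] real_sqrt_mult)

lemma geodesic_space_cube: "geodesic_space (cube_points B) (complex_dist (cube_cubes B))"
proof -
  have "\<exists>\<gamma>. geodesic_from_to (cube_points B) (complex_dist (cube_cubes B)) \<gamma> x y"
    if x: "x \<in> cube_points B" and y: "y \<in> cube_points B" for x y
  proof -
    define d where "d = finite_dist x y"
    define \<gamma> where "\<gamma> s = (\<lambda>j. (1 - s / d) * x j + s / d * y j)" for s
    have d0: "0 \<le> d" by (simp add: d_def finite_dist_nonneg)
    have D: "complex_dist (cube_cubes B) x y = d" using x y by (simp add: complex_dist_cube d_def)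
    have mem: "\<gamma> s \<in> cube_points B" if "s \<in> {0..d}" for s
      unfolding \<gamma>_def using that by (intro convex_comb_points[OF x y]) (auto simp: divide_simps)
    have dist: "finite_dist (\<gamma> s) (\<gamma> t) = \<bar>s - t\<bar>" if s: "s \<in> {0..d}" and t: "t \<in> {0..d}" for s t
    proof (cases "d = 0")
      case True
      then show ?thesis using s t finite_dist_zero_iff[OF mem[OF s] mem[OF s]] by simp
    next
      case False
      define F where "F = {j. x j \<noteq> y j}"
      have F: "finite F" using finite_differ[OF x y] by (simp add: F_def)
      have eq: "\<gamma> s j - \<gamma> t j = ((t - s) / d) * (x j - y j)" for j
        using False by (simp add: \<gamma>_def field_simps)
      have "finite_dist (\<gamma> s) (\<gamma> t) = L2_set (\<lambda>j. \<gamma> s j - \<gamma> t j) F"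
      proof (rule finite_dist_eq[OF F], rule subsetI, rule ccontr)
        fix j assume "j \<in> {j. \<gamma> s j \<noteq> \<gamma> t j}" "j \<notin> F"
        then show False using eq[of j] by (auto simp: F_def)
      qed
      also have "\<dots> = \<bar>(t - s) / d\<bar> * d"
        unfolding eq L2_set_scale by (simp add: d_def finite_dist_def F_def)
      also have "\<dots> = \<bar>s - t\<bar>" using False d0 by (simp add: abs_divide abs_minus_commute)
      finally show ?thesis .
    qed
    have "\<gamma> 0 = x" by (simp add: \<gamma>_def)
    moreover have "\<gamma> d = y"
    proof (cases "d = 0")
      case True
      then show ?thesis using x y by (simp add: \<gamma>_def d_def finite_dist_zero_iff)
    qed (simp add: \<gamma>_def)
    ultimately show ?thesis
      unfolding geodesic_from_to_def D
      using mem dist by (intro exI[of _ \<gamma>]) (auto simp: complex_dist_cube)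
  qed
  then show ?thesis by (simp add: geodesic_space_def Metric_space_cube)
qed

text \<open>The comparison point has the same barycentric parameter as the point on the geodesic.
  For \<open>p = q\<close> the quotient is 0 by convention, matching the degenerate case of
  \<open>geodesic_straight\<close>.\<close>

lemma segment_point:
  fixes p q x :: "real^2"
  assumes "x \<in> closed_segment p q"
  shows "x = (1 - dist p x / dist p q) *\<^sub>R p + (dist p x / dist p q) *\<^sub>R q"
proof -
  from assms obtain u where u: "0 \<le> u" "x = (1 - u) *\<^sub>R p + u *\<^sub>R q" by (auto simp: closed_segment_def)
  have "p - x = u *\<^sub>R (p - q)" by (simp add: u algebra_simps)
  then have "dist p x = u * dist p q" using u(1) by (simp add: dist_norm)
  then show ?thesis using u by (cases "p = q") auto
qed

text \<open>Equality holds. Stewart's formula along the side from \<open>p\<close> to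
  \<open>r\<close>, seen from \<open>\<gamma> s\<close>, and then along the side from
  \<open>p\<close> to \<open>q\<close>, seen from \<open>p\<close> and from \<open>r\<close>,
  expresses the distance by the side lengths; the plane obeys the same formulas.\<close>

lemma CAT0_space_cube: "CAT0_space (cube_points B) (complex_dist (cube_cubes B))"
proof -
  let ?D = "complex_dist (cube_cubes B)"
  have "?D (\<gamma> s) (\<delta> t) \<le> dist x' y'"
    if p: "p \<in> cube_points B" and q: "q \<in> cube_points B" and r: "r \<in> cube_points B"
      and \<gamma>: "geodesic_from_to (cube_points B) ?D \<gamma> p q"
      and \<delta>: "geodesic_from_to (cube_points B) ?D \<delta> p r"
      and pq: "dist p' q' = ?D p q" and qr: "dist q' r' = ?D q r" and pr: "dist p' r' = ?D p r"
      and s: "s \<in> {0..?D p q}" and t: "t \<in> {0..?D p r}"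
      and x': "x' \<in> closed_segment p' q'" and y': "y' \<in> closed_segment p' r'"
      and ps: "dist p' x' = s" and pt: "dist p' y' = t"
    for p q r \<gamma> \<delta> s t x' y' and p' q' r' :: "real^2"
  proof -
    note D = complex_dist_cube[of _ B]
    define a where "a = s / finite_dist p q"
    define b where "b = t / finite_dist p r"
    have xa: "x' = (1 - a) *\<^sub>R p' + a *\<^sub>R q'" and yb: "y' = (1 - b) *\<^sub>R p' + b *\<^sub>R r'"
      using segment_point[OF x'] segment_point[OF y'] ps pt pq pr p q r by (simp_all add: a_def b_def D)
    have ga: "\<gamma> s = (\<lambda>j. (1 - a) * p j + a * q j)" and db: "\<delta> t = (\<lambda>j. (1 - b) * p j + b * r j)"
      using geodesic_straight[OF \<gamma> p q] geodesic_straight[OF \<delta> p r] s t p q r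
      by (simp_all add: a_def b_def D)
    have gs: "\<gamma> s \<in> cube_points B" and dt: "\<delta> t \<in> cube_points B"
      using \<gamma> \<delta> s t by (auto simp: geodesic_from_to_def)
    have e: "dist p' q' = finite_dist p q" "dist r' q' = finite_dist r q" "dist p' r' = finite_dist p r"
        "dist r' p' = finite_dist r p"
      using pq qr pr p q r by (simp_all add: D dist_commute finite_dist_commute)
    have self: "finite_dist p p = 0" by (simp add: finite_dist_def)
    have "(finite_dist (\<gamma> s) (\<delta> t))\<^sup>2 = (1 - b) * (finite_dist p (\<gamma> s))\<^sup>2 + b * (finite_dist r (\<gamma> s))\<^sup>2
        - b * (1 - b) * (finite_dist p r)\<^sup>2"
      using Stewart_cube[OF p r gs, of b] by (simp add: db finite_dist_commute)
    also have "\<dots> = (1 - b) * (dist p' x')\<^sup>2 + b * (dist r' x')\<^sup>2 - b * (1 - b) * (dist p' r')\<^sup>2"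
      using Stewart_cube[OF p q p, of a] Stewart_cube[OF p q r, of a]
        Stewart_plane[of p' a p' q'] Stewart_plane[of r' a p' q']
      by (simp add: ga xa e self)
    also have "\<dots> = (dist x' y')\<^sup>2"
      using Stewart_plane[of x' b p' r'] by (simp add: yb dist_commute)
    finally have "finite_dist (\<gamma> s) (\<delta> t) = dist x' y'"
      by (simp add: power2_eq_iff_nonneg finite_dist_nonneg)
    then show ?thesis using gs dt by (simp add: D)
  qed
  then show ?thesis unfolding CAT0_space_def using geodesic_space_cube by blast
qed

lemma CAT0_cubical_complex_cube: "CAT0_cubical_complex (cube_cubes B)"
  unfolding CAT0_cubical_complex_def complex_points_cube
  using cubical_complex_cube CAT0_space_cube string_between_ex by blast

section \<open>The cubical action and its lack of fixed points\<close>

context commensurating_action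
begin

definition cube_action :: "'a \<Rightarrow> (nat \<Rightarrow> real) \<Rightarrow> nat \<Rightarrow> real"
  where "cube_action g = (\<lambda>x\<in>cube_points B. \<lambda>j. x (\<phi> (inv g) j))"

text \<open>The permuted point can deviate from \<open>B\<close> only at the translates of the old
  deviations or where \<open>g\<close> moves \<open>B\<close>. This is where finiteness of the
  displacement is used.\<close>

lemma permuted_point:
  assumes g: "g \<in> carrier G" and x: "x \<in> cube_points B"
  shows "(\<lambda>j. x (\<phi> (inv g) j)) \<in> cube_points B"
proof -
  have "finite (\<phi> g ` {j. x j \<noteq> indicator B j} \<union> sym_diff (\<phi> g ` B) B)"
    using x finite_defect[OF g] by (simp add: cube_points_def)
  moreover have "{j. x (\<phi> (inv g) j) \<noteq> indicator B j} \<subseteq>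
      \<phi> g ` {j. x j \<noteq> indicator B j} \<union> sym_diff (\<phi> g ` B) B"
  proof
    fix j assume j: "j \<in> {j. x (\<phi> (inv g) j) \<noteq> indicator B j}"
    show "j \<in> \<phi> g ` {j. x j \<noteq> indicator B j} \<union> sym_diff (\<phi> g ` B) B"
      using j by (auto simp: mem_image_action[OF g] indicator_def)
  qed
  ultimately have "finite {j. x (\<phi> (inv g) j) \<noteq> indicator B j}" by (rule finite_subset[rotated])
  then show ?thesis using x by (auto simp: cube_points_def)
qed

text \<open>A permutation of the coordinates renames the free ones and permutes the base vertex
  while keeping the parameter \<open>u\<close>. In the parameters of the cubes the action is
  therefore the identity.\<close>

lemma permuted_chart:
  assumes g: "g \<in> carrier G" and q: "inj_on q {..<n}"
  shows "chart n q v u (\<phi> (inv g) j) = chart n (\<phi> g \<circ> q) (\<lambda>j. v (\<phi> (inv g) j)) u j"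
proof (cases "\<phi> (inv g) j \<in> q ` {..<n}")
  case True
  then obtain i where i: "i < n" "\<phi> (inv g) j = q i" by auto
  then have j: "j = (\<phi> g \<circ> q) i" using act_inv[OF g, of j] by simp
  have "inj_on (\<phi> g \<circ> q) {..<n}" using q bij_action[OF g] by (metis bij_def comp_inj_on inj_on_subset subset_UNIV)
  then show ?thesis using i q chart_image[of "\<phi> g \<circ> q" n i] chart_image[OF q i(1)] by (metis j)
next
  case False
  then have "j \<notin> (\<phi> g \<circ> q) ` {..<n}"
    by (metis image_comp mem_image_action[OF g])
  then show ?thesis using False by (simp add: chart_outside)
qed

lemma group_action_cube: "group_action G (cube_points B) cube_action"
proof (rule group_actionI)
  show "group G" by (rule G.is_group)
qed (auto simp: cube_action_def permuted_point act_one act_mult G.inv_mult_group)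

lemma acts_cubically_cube: "acts_cubically G (cube_cubes B) cube_action"
proof -
  have "cubical_automorphism (cube_cubes B) (cube_action g)" if g: "g \<in> carrier G" for g
  proof -
    interpret C: group_action G "cube_points B" cube_action by (rule group_action_cube)
    have "bij_betw (cube_action g) (cube_points B) (cube_points B)"
      using C.bij_prop0[OF g] by (simp add: Bij_def)
    moreover have "\<exists>(n', \<sigma>')\<in>cube_cubes B. \<exists>h. cube_isometry n (unit_cube n) n' (unit_cube n') h \<and>
        (\<forall>u\<in>unit_cube n. cube_action g (\<sigma> u) = \<sigma>' (h u))" if s: "(n, \<sigma>) \<in> cube_cubes B" for n \<sigma>
    proof -
      from s obtain q v where q: "inj_on q {..<n}" and v: "v \<in> cube_vertices B"
        and \<sigma>: "\<sigma> = chart n q v" by (auto simp: cube_cubes_def)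
      define \<sigma>' where "\<sigma>' = chart n (\<phi> g \<circ> q) (\<lambda>j. v (\<phi> (inv g) j))"
      have "inj_on (\<phi> g \<circ> q) {..<n}"
        using q bij_action[OF g] by (metis bij_def comp_inj_on inj_on_subset subset_UNIV)
      moreover have "(\<lambda>j. v (\<phi> (inv g) j)) \<in> cube_vertices B"
        using v permuted_point[OF g] by (simp add: cube_vertices_def)
      ultimately have "(n, \<sigma>') \<in> cube_cubes B" by (auto simp: cube_cubes_def \<sigma>'_def)
      moreover have "cube_isometry n (unit_cube n) n (unit_cube n) id"
        by (simp add: cube_isometry_def)
      moreover have "cube_action g (\<sigma> u) = \<sigma>' (id u)" if "u \<in> unit_cube n" for u
        using chart_points[OF q v that] by (auto simp: cube_action_def \<sigma> \<sigma>'_def permuted_chart[OF g q])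
      ultimately show ?thesis by fastforce
    qed
    ultimately show ?thesis unfolding cubical_automorphism_def complex_points_cube by blast
  qed
  then show ?thesis by (simp add: acts_cubically_def complex_points_cube group_action_cube)
qed

lemma no_fixed_point_cube: "\<not> has_fixed_point G (cube_points B) cube_action"
proof
  assume "has_fixed_point G (cube_points B) cube_action"
  then obtain x where x: "x \<in> cube_points B" and fix': "\<And>g. g \<in> carrier G \<Longrightarrow> cube_action g x = x"
    by (auto simp: has_fixed_point_def)
  define F where "F = {j. x j \<noteq> indicator B j}"
  have F: "finite F" using x by (simp add: F_def cube_points_def)
  obtain g where g: "g \<in> carrier G" and card: "2 * card F + 1 \<le> card (sym_diff (\<phi> g ` B) B)"
    using unbounded_defect by blast
  have inv: "x (\<phi> (inv g) j) = x j" for j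
    using fix'[OF g] x by (metis cube_action_def restrict_apply')
  have "sym_diff (\<phi> g ` B) B \<subseteq> F \<union> \<phi> g ` F"
  proof
    fix j assume "j \<in> sym_diff (\<phi> g ` B) B"
    then show "j \<in> F \<union> \<phi> g ` F"
      using inv[of j] by (auto simp: mem_image_action[OF g] F_def indicator_def split: if_splits)
  qed
  then have "card (sym_diff (\<phi> g ` B) B) \<le> card (F \<union> \<phi> g ` F)" using F by (intro card_mono) auto
  also have "\<dots> \<le> card F + card F" using card_Un_le[of F "\<phi> g ` F"] card_image_le[OF F, of "\<phi> g"] by linarith
  finally show False using card by simp
qed

end

section \<open>Square summable functions\<close>

definition square_summable :: "'j set \<Rightarrow> ('j \<Rightarrow> complex) \<Rightarrow> bool"
  where "square_summable J f \<longleftrightarrow> (\<lambda>j. (cmod (f j))\<^sup>2) summable_on J"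

definition l2_norm :: "'j set \<Rightarrow> ('j \<Rightarrow> complex) \<Rightarrow> real"
  where "l2_norm J f = sqrt (\<Sum>\<^sub>\<infinity>j\<in>J. (cmod (f j))\<^sup>2)"

definition l2_ip :: "'j set \<Rightarrow> ('j \<Rightarrow> complex) \<Rightarrow> ('j \<Rightarrow> complex) \<Rightarrow> complex"
  where "l2_ip J f g = (\<Sum>\<^sub>\<infinity>j\<in>J. f j * cnj (g j))"

lemma square_summable_cong:
  "(\<And>j. j \<in> J \<Longrightarrow> f j = g j) \<Longrightarrow> square_summable J f = square_summable J g"
  unfolding square_summable_def by (intro summable_on_cong) simp

lemma l2_ip_cong:
  "(\<And>j. j \<in> J \<Longrightarrow> f j = f' j) \<Longrightarrow> (\<And>j. j \<in> J \<Longrightarrow> g j = g' j) \<Longrightarrow> l2_ip J f g = l2_ip J f' g'"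
  unfolding l2_ip_def by (intro infsum_cong) simp

lemma l2_norm_cong: "(\<And>j. j \<in> J \<Longrightarrow> f j = g j) \<Longrightarrow> l2_norm J f = l2_norm J g"
  unfolding l2_norm_def by (intro arg_cong[where f = sqrt] infsum_cong) simp

lemma square_summable_0 [simp]: "square_summable J (\<lambda>_. 0)"
  by (simp add: square_summable_def)

lemma square_summable_cmult: "square_summable J f \<Longrightarrow> square_summable J (\<lambda>j. c * f j)"
  by (simp add: square_summable_def norm_mult power_mult_distrib summable_on_cmult_right)

lemma square_summable_add:
  assumes "square_summable J f" "square_summable J g"
  shows "square_summable J (\<lambda>j. f j + g j)"
  unfolding square_summable_def
proof (rule summable_on_comparison_test)
  show "(\<lambda>j. 2 * (cmod (f j))\<^sup>2 + 2 * (cmod (g j))\<^sup>2) summable_on J"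
    using assms by (intro summable_on_add summable_on_cmult_right) (auto simp: square_summable_def)
  fix j
  have "(cmod (f j + g j))\<^sup>2 \<le> (cmod (f j) + cmod (g j))\<^sup>2"
    by (intro power_mono norm_triangle_ineq) auto
  also have "\<dots> \<le> 2 * (cmod (f j))\<^sup>2 + 2 * (cmod (g j))\<^sup>2"
    using zero_le_power2[of "cmod (f j) - cmod (g j)"]
    by (simp add: power2_eq_square algebra_simps)
  finally show "(cmod (f j + g j))\<^sup>2 \<le> 2 * (cmod (f j))\<^sup>2 + 2 * (cmod (g j))\<^sup>2" .
qed auto

lemma square_summable_diff:
  assumes "square_summable J f" "square_summable J g"
  shows "square_summable J (\<lambda>j. f j - g j)"
  using square_summable_add[OF assms(1) square_summable_cmult[OF assms(2), of "-1"]] by simp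

lemma square_summable_prod:
  assumes "square_summable J f" "square_summable J g"
  shows "(\<lambda>j. f j * cnj (g j)) summable_on J"
proof (rule abs_summable_summable, rule summable_on_comparison_test)
  show "(\<lambda>j. (cmod (f j))\<^sup>2 + (cmod (g j))\<^sup>2) summable_on J"
    using assms by (intro summable_on_add) (auto simp: square_summable_def)
  fix j
  have "2 * (cmod (f j) * cmod (g j)) \<le> (cmod (f j))\<^sup>2 + (cmod (g j))\<^sup>2"
    using zero_le_power2[of "cmod (f j) - cmod (g j)"]
    by (simp add: power2_eq_square algebra_simps)
  moreover have "0 \<le> cmod (f j) * cmod (g j)" by simp
  ultimately have "cmod (f j) * cmod (g j) \<le> (cmod (f j))\<^sup>2 + (cmod (g j))\<^sup>2" by linarith
  then show "cmod (f j * cnj (g j)) \<le> (cmod (f j))\<^sup>2 + (cmod (g j))\<^sup>2"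
    by (simp add: norm_mult)
qed auto

lemma l2_ip_self: 
  assumes "square_summable J f"
  shows "l2_ip J f f = of_real ((l2_norm J f)\<^sup>2)"
proof -
  have "l2_ip J f f = (\<Sum>\<^sub>\<infinity>j\<in>J. of_real ((cmod (f j))\<^sup>2))"
    unfolding l2_ip_def by (intro infsum_cong) (metis complex_norm_square of_real_power)
  also have "\<dots> = of_real (\<Sum>\<^sub>\<infinity>j\<in>J. (cmod (f j))\<^sup>2)"
    using assms by (intro infsumI has_sum_of_real) (simp add: square_summable_def)
  finally show ?thesis by (simp add: l2_norm_def infsum_nonneg)
qed

lemma L2_set_le_l2_norm:
  assumes "square_summable J f" "finite F" "F \<subseteq> J"
  shows "L2_set (\<lambda>j. cmod (f j)) F \<le> l2_norm J f"
  unfolding L2_set_def l2_norm_def using assms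
  by (intro real_sqrt_le_mono finite_sum_le_infsum) (auto simp: square_summable_def)

lemma norm_le_l2_norm:
  assumes "square_summable J f" "j \<in> J"
  shows "cmod (f j) \<le> l2_norm J f"
  using L2_set_le_l2_norm[OF assms(1), of "{j}"] assms(2) by simp

text \<open>A uniform bound on finite subsets gives both summability and the norm bound. Triangle
  inequality and completeness are thus reduced to \<open>L2_set\<close> on finite sets.\<close>

lemma l2_norm_bound:
  assumes b: "0 \<le> b" and F: "\<And>F. finite F \<Longrightarrow> F \<subseteq> J \<Longrightarrow> L2_set (\<lambda>j. cmod (f j)) F \<le> b"
  shows "square_summable J f" "l2_norm J f \<le> b"
proof -
  have *: "(\<Sum>j\<in>F. (cmod (f j))\<^sup>2) \<le> b\<^sup>2" if "finite F" "F \<subseteq> J" for F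
    using F[OF that] b by (simp add: L2_set_def sum_nonneg real_le_rsqrt sqrt_le_D)
  then show s: "square_summable J f"
    unfolding square_summable_def by (intro nonneg_bdd_above_summable_on bdd_aboveI2[of _ _ "b\<^sup>2"]) auto
  have "(\<Sum>\<^sub>\<infinity>j\<in>J. (cmod (f j))\<^sup>2) \<le> b\<^sup>2"
    using s * by (intro infsum_le_finite_sums) (auto simp: square_summable_def)
  then show "l2_norm J f \<le> b"
    unfolding l2_norm_def using b by (simp add: real_le_lsqrt infsum_nonneg)
qed

lemma l2_norm_nonneg: "0 \<le> l2_norm J f"
  by (simp add: l2_norm_def infsum_nonneg)

lemma l2_norm_triangle:
  assumes "square_summable J f" "square_summable J g"
  shows "l2_norm J (\<lambda>j. f j + g j) \<le> l2_norm J f + l2_norm J g"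
proof (rule l2_norm_bound(2))
  fix F assume F: "finite F" "F \<subseteq> J"
  have "L2_set (\<lambda>j. cmod (f j + g j)) F \<le> L2_set (\<lambda>j. cmod (f j) + cmod (g j)) F"
    by (intro L2_set_mono norm_triangle_ineq) auto
  also have "\<dots> \<le> L2_set (\<lambda>j. cmod (f j)) F + L2_set (\<lambda>j. cmod (g j)) F"
    by (rule L2_set_triangle_ineq)
  also have "\<dots> \<le> l2_norm J f + l2_norm J g"
    using assms F by (intro add_mono L2_set_le_l2_norm)
  finally show "L2_set (\<lambda>j. cmod (f j + g j)) F \<le> l2_norm J f + l2_norm J g" .
qed (simp add: l2_norm_nonneg)

lemma l2_norm_eq_0_iff:
  assumes "square_summable J f"
  shows "l2_norm J f = 0 \<longleftrightarrow> (\<forall>j\<in>J. f j = 0)"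
proof
  assume "l2_norm J f = 0"
  then show "\<forall>j\<in>J. f j = 0" using norm_le_l2_norm[OF assms] by fastforce
next
  assume "\<forall>j\<in>J. f j = 0"
  then have "l2_norm J f = l2_norm J (\<lambda>_. 0)" by (intro l2_norm_cong) auto
  then show "l2_norm J f = 0" by (simp add: l2_norm_def)
qed

lemma l2_norm_minus: "l2_norm J (\<lambda>j. g j - f j) = l2_norm J (\<lambda>j. f j - g j)"
  by (simp add: l2_norm_def norm_minus_commute)

text \<open>The candidate is the pointwise limit. The Cauchy estimate is carried to the limit on
  each finite set of indices and then extended to all of \<open>J\<close>.\<close>

lemma l2_complete:
  fixes f :: "nat \<Rightarrow> 'j \<Rightarrow> complex"
  assumes f: "\<And>n. square_summable J (f n)"
    and Cauchy: "\<And>e. e > 0 \<Longrightarrow> \<exists>N. \<forall>m\<ge>N. \<forall>n\<ge>N. l2_norm J (\<lambda>j. f m j - f n j) < e"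
  obtains g where "square_summable J g"
    "\<And>e. e > 0 \<Longrightarrow> \<exists>N. \<forall>n\<ge>N. l2_norm J (\<lambda>j. f n j - g j) < e"
proof -
  have "Cauchy (\<lambda>n. f n j)" if j: "j \<in> J" for j
  proof (rule metric_CauchyI)
    fix e :: real assume "e > 0"
    then obtain N where N: "\<forall>m\<ge>N. \<forall>n\<ge>N. l2_norm J (\<lambda>j. f m j - f n j) < e" using Cauchy by blast
    have "dist (f m j) (f n j) < e" if "m \<ge> N" "n \<ge> N" for m n
      using norm_le_l2_norm[OF square_summable_diff[OF f[of m] f[of n]] j] N that
      by (fastforce simp: dist_norm)
    then show "\<exists>M. \<forall>m\<ge>M. \<forall>n\<ge>M. dist (f m j) (f n j) < e" by blast
  qed
  then have "\<exists>l. j \<in> J \<longrightarrow> (\<lambda>n. f n j) \<longlonglongrightarrow> l" for j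
    using Cauchy_convergent_iff[of "\<lambda>n. f n j"] by (auto simp: convergent_def)
  then obtain g where g: "\<And>j. j \<in> J \<Longrightarrow> (\<lambda>n. f n j) \<longlonglongrightarrow> g j" by metis
  have lim: "\<exists>N. \<forall>n\<ge>N. square_summable J (\<lambda>j. f n j - g j) \<and> l2_norm J (\<lambda>j. f n j - g j) \<le> e"
    if e: "e > 0" for e
  proof -
    obtain N where N: "\<forall>m\<ge>N. \<forall>n\<ge>N. l2_norm J (\<lambda>j. f m j - f n j) < e" using Cauchy[OF e] by blast
    \<comment> \<open>Keep \<open>n\<close> and the finite set \<open>F\<close> fixed and let the
      other index \<open>m\<close> tend to infinity.\<close>
    have "L2_set (\<lambda>j. cmod (f n j - g j)) F \<le> e" if n: "n \<ge> N" and F: "finite F" "F \<subseteq> J" for n F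
    proof (rule LIMSEQ_le_const2)
      have "(\<lambda>m. f n j - f m j) \<longlonglongrightarrow> f n j - g j" if "j \<in> F" for j
        using that F g by (intro tendsto_diff tendsto_const) auto
      then show "(\<lambda>m. L2_set (\<lambda>j. cmod (f n j - f m j)) F) \<longlonglongrightarrow> L2_set (\<lambda>j. cmod (f n j - g j)) F"
        unfolding L2_set_def
        by (intro tendsto_real_sqrt tendsto_sum tendsto_power tendsto_norm)
      show "\<exists>M. \<forall>m\<ge>M. L2_set (\<lambda>j. cmod (f n j - f m j)) F \<le> e"
      proof (intro exI[of _ N] allI impI)
        fix m assume "m \<ge> N"
        then have "l2_norm J (\<lambda>j. f n j - f m j) < e" using N n by blast
        with L2_set_le_l2_norm[OF square_summable_diff[OF f[of n] f[of m]] F]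
        show "L2_set (\<lambda>j. cmod (f n j - f m j)) F \<le> e" by linarith
      qed
    qed
    then show ?thesis using l2_norm_bound[of e J] e by (intro exI[of _ N]) auto
  qed
  show thesis
  proof (rule that)
    obtain n where "square_summable J (\<lambda>j. f n j - g j)" using lim[of 1] by auto
    from square_summable_diff[OF f[of n] this] show "square_summable J g" by simp
    show "\<exists>N. \<forall>n\<ge>N. l2_norm J (\<lambda>j. f n j - g j) < e" if "e > 0" for e
    proof -
      \<comment> \<open>The limit estimate is only weak, and halving \<open>e\<close> makes it
        strict.\<close>
      obtain N where "\<forall>n\<ge>N. l2_norm J (\<lambda>j. f n j - g j) \<le> e / 2" using lim[of "e / 2"] half_gt_zero[OF \<open>e > 0\<close>] by blast
      moreover have "e / 2 < e" using that by simp
      ultimately show ?thesis by (meson le_less_trans)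
    qed
  qed
qed

text \<open>The functions on \<open>\<iota> ` J\<close> are extended by \<open>0\<close>, so that \<open>\<ell>\<^sup>2(J)\<close> fits into the type of functions
  on any type that contains a copy of \<open>J\<close>. The fields \<open>mult\<close> and \<open>one\<close> play no role.\<close>

definition l2_module :: "('j \<Rightarrow> 'i) \<Rightarrow> 'j set \<Rightarrow> ('i \<Rightarrow> complex) inner_module"
  where "l2_module \<iota> J =
    \<lparr> carrier = {x. (\<forall>p. p \<notin> \<iota> ` J \<longrightarrow> x p = 0) \<and> square_summable J (x \<circ> \<iota>)},
      mult = (\<lambda>x y. x), one = (\<lambda>_. 0), zero = (\<lambda>_. 0), add = (\<lambda>x y p. x p + y p),
      smult = (\<lambda>c x p. c * x p), ip = (\<lambda>x y. l2_ip J (x \<circ> \<iota>) (y \<circ> \<iota>)) \<rparr>"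

lemma l2_module_simps [simp]:
  "carrier (l2_module \<iota> J) = {x. (\<forall>p. p \<notin> \<iota> ` J \<longrightarrow> x p = 0) \<and> square_summable J (x \<circ> \<iota>)}"
  "zero (l2_module \<iota> J) = (\<lambda>_. 0)" "add (l2_module \<iota> J) = (\<lambda>x y p. x p + y p)"
  "smult (l2_module \<iota> J) = (\<lambda>c x p. c * x p)"
  "ip (l2_module \<iota> J) = (\<lambda>x y. l2_ip J (x \<circ> \<iota>) (y \<circ> \<iota>))"
  by (simp_all add: l2_module_def)

lemma abelian_group_l2: "abelian_group (l2_module \<iota> J)"
proof (rule abelian_groupI)
  fix x assume x: "x \<in> carrier (l2_module \<iota> J)"
  have "(\<lambda>p. - x p) \<in> carrier (l2_module \<iota> J)"
    using x square_summable_cmult[of J "x \<circ> \<iota>" "-1"] by (simp add: comp_def)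
  then show "\<exists>y\<in>carrier (l2_module \<iota> J). y \<oplus>\<^bsub>l2_module \<iota> J\<^esub> x = \<zero>\<^bsub>l2_module \<iota> J\<^esub>"
    by (intro bexI[of _ "\<lambda>p. - x p"]) simp_all
qed (auto simp: comp_def square_summable_add add_ac)

lemma cring_complex_ring: "cring complex_ring"
proof (rule cringI)
  show "abelian_group complex_ring"
    by (rule abelian_groupI)
      (auto simp: complex_ring_def add_ac intro: exI[of _ "- _"] add.left_inverse)
  show "Group.comm_monoid complex_ring"
    by (rule comm_monoidI) (auto simp: complex_ring_def)
qed (simp add: complex_ring_def algebra_simps)

lemma module_l2: "Module.module complex_ring (l2_module \<iota> J)"
  using cring_complex_ring abelian_group_l2[of \<iota> J]
  by (auto intro!: moduleI simp: complex_ring_def square_summable_cmult comp_def algebra_simps)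

lemma l2_module_minus:
  assumes "x \<in> carrier (l2_module \<iota> J)" "y \<in> carrier (l2_module \<iota> J)"
  shows "x \<ominus>\<^bsub>l2_module \<iota> J\<^esub> y = (\<lambda>p. x p - y p)"
proof -
  interpret abelian_group "l2_module \<iota> J" by (rule abelian_group_l2)
  have "(\<lambda>p. - y p) \<in> carrier (l2_module \<iota> J)"
    using assms square_summable_cmult[of J "y \<circ> \<iota>" "-1"] by (simp add: comp_def)
  then have "\<ominus>\<^bsub>l2_module \<iota> J\<^esub> y = (\<lambda>p. - y p)"
    using assms by (intro minus_equality) auto
  then show ?thesis by (simp add: a_minus_def)
qed

lemma hnorm_l2: 
  assumes "x \<in> carrier (l2_module \<iota> J)"
  shows "hnorm (l2_module \<iota> J) x = l2_norm J (x \<circ> \<iota>)"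
  using assms by (simp add: hnorm_def l2_ip_self l2_norm_nonneg)

lemma hdist_l2:
  assumes "x \<in> carrier (l2_module \<iota> J)" "y \<in> carrier (l2_module \<iota> J)"
  shows "hdist (l2_module \<iota> J) x y = l2_norm J (\<lambda>j. x (\<iota> j) - y (\<iota> j))"
proof -
  have "(\<lambda>p. x p - y p) \<in> carrier (l2_module \<iota> J)"
    using assms square_summable_diff[of J "x \<circ> \<iota>" "y \<circ> \<iota>"] by (simp add: comp_def)
  from hnorm_l2[OF this] show ?thesis
    using assms by (simp add: hdist_def l2_module_minus[OF assms] comp_def del: l2_module_simps)
qed

lemma l2_eqI:
  assumes "x \<in> carrier (l2_module \<iota> J)" "y \<in> carrier (l2_module \<iota> J)"
    and "\<And>j. j \<in> J \<Longrightarrow> x (\<iota> j) = y (\<iota> j)"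
  shows "x = y"
proof
  fix p show "x p = y p" using assms by (cases "p \<in> \<iota> ` J") auto
qed

lemma Metric_space_l2: "Metric_space (carrier (l2_module \<iota> J)) (hdist (l2_module \<iota> J))"
proof
  let ?H = "l2_module \<iota> J"
  note [simp del] = l2_module_simps
  fix x y
  show "0 \<le> hdist ?H x y"
    using hdist_l2[of x \<iota> J y] l2_norm_nonneg by (auto simp: hdist_def)
  show "hdist ?H x y = hdist ?H y x"
    using hdist_l2[of x \<iota> J y] hdist_l2[of y \<iota> J x]
      l2_norm_minus[of J "\<lambda>j. x (\<iota> j)" "\<lambda>j. y (\<iota> j)"]
    by (cases "x \<in> carrier ?H \<and> y \<in> carrier ?H") (auto simp: hdist_def)
next
  let ?H = "l2_module \<iota> J"
  fix x y assume xy: "x \<in> carrier ?H" "y \<in> carrier ?H"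
  have d: "square_summable J (\<lambda>j. x (\<iota> j) - y (\<iota> j))"
    if "x \<in> carrier ?H" "y \<in> carrier ?H" for x y
    using that square_summable_diff[of J "x \<circ> \<iota>" "y \<circ> \<iota>"] by (simp add: comp_def)
  show "hdist ?H x y = 0 \<longleftrightarrow> x = y"
    using l2_eqI[OF xy] by (auto simp: hdist_l2[OF xy] l2_norm_eq_0_iff[OF d[OF xy]])
  fix z assume z: "z \<in> carrier ?H"
  show "hdist ?H x z \<le> hdist ?H x y + hdist ?H y z"
    using l2_norm_triangle[OF d[OF xy] d[OF xy(2) z]]
    by (simp add: hdist_l2[OF xy] hdist_l2[OF xy(2) z] hdist_l2[OF xy(1) z] del: l2_module_simps)
qed

definition l2_embed :: "('j \<Rightarrow> 'i) \<Rightarrow> 'j set \<Rightarrow> ('j \<Rightarrow> complex) \<Rightarrow> 'i \<Rightarrow> complex"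
  where "l2_embed \<iota> J f = (\<lambda>p. if p \<in> \<iota> ` J then f (inv_into J \<iota> p) else 0)"

lemma l2_embed_apply: "inj_on \<iota> J \<Longrightarrow> j \<in> J \<Longrightarrow> l2_embed \<iota> J f (\<iota> j) = f j"
  by (simp add: l2_embed_def)

lemma l2_embed_carrier:
  assumes "inj_on \<iota> J" "square_summable J f"
  shows "l2_embed \<iota> J f \<in> carrier (l2_module \<iota> J)"
  using assms square_summable_cong[of J "l2_embed \<iota> J f \<circ> \<iota>" f]
  by (auto simp: l2_embed_apply) (auto simp: l2_embed_def)

lemma complex_hilbert_space_l2:
  assumes \<iota>: "inj_on \<iota> J"
  shows "complex_hilbert_space (l2_module \<iota> J)"
proof -
  let ?H = "l2_module \<iota> J"
  interpret M: Metric_space "carrier ?H" "hdist ?H" by (rule Metric_space_l2)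
  have "M.mcomplete"
    unfolding M.mcomplete_def
  proof (intro allI impI)
    fix \<sigma> assume C: "M.MCauchy \<sigma>"
    then have \<sigma>: "\<sigma> n \<in> carrier ?H" for n unfolding M.MCauchy_def by blast
    then have sq: "square_summable J (\<lambda>j. \<sigma> n (\<iota> j))" for n using \<sigma>[of n] by (simp add: comp_def)
    have "\<exists>N. \<forall>m\<ge>N. \<forall>n\<ge>N. l2_norm J (\<lambda>j. \<sigma> m (\<iota> j) - \<sigma> n (\<iota> j)) < e" if "e > 0" for e
      using C that by (auto simp: M.MCauchy_def hdist_l2[OF \<sigma> \<sigma>] simp del: l2_module_simps)
    with sq obtain g where g: "square_summable J g"
      "\<And>e. e > 0 \<Longrightarrow> \<exists>N. \<forall>n\<ge>N. l2_norm J (\<lambda>j. \<sigma> n (\<iota> j) - g j) < e"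
      using l2_complete[of J "\<lambda>n j. \<sigma> n (\<iota> j)"] by metis
    define x where "x = l2_embed \<iota> J g"
    have x: "x \<in> carrier ?H" unfolding x_def by (rule l2_embed_carrier[OF \<iota> g(1)])
    have "hdist ?H (\<sigma> n) x = l2_norm J (\<lambda>j. \<sigma> n (\<iota> j) - g j)" for n
      unfolding hdist_l2[OF \<sigma> x] by (intro l2_norm_cong) (simp add: x_def l2_embed_apply[OF \<iota>])
    then have "limitin M.mtopology \<sigma> x sequentially"
      using x \<sigma> g(2) by (simp add: M.limit_metric_sequentially del: l2_module_simps)
    then show "\<exists>x. limitin M.mtopology \<sigma> x sequentially" by (intro exI[of _ x])
  qed
  moreover have "Re (ip ?H x x) > 0" if x: "x \<in> carrier ?H" "x \<noteq> \<zero>\<^bsub>?H\<^esub>" for x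
  proof -
    have "l2_norm J (x \<circ> \<iota>) \<noteq> 0"
    proof
      assume "l2_norm J (x \<circ> \<iota>) = 0"
      then have "x p = 0" for p
        using x l2_norm_eq_0_iff[of J "x \<circ> \<iota>"] by (cases "p \<in> \<iota> ` J") auto
      then show False using x by auto
    qed
    then show ?thesis using x by (simp add: l2_ip_self)
  qed
  moreover have "ip ?H (x \<oplus>\<^bsub>?H\<^esub> y) z = ip ?H x z + ip ?H y z"
    if "x \<in> carrier ?H" "y \<in> carrier ?H" "z \<in> carrier ?H" for x y z
    using that infsum_add[OF square_summable_prod square_summable_prod, of J "x \<circ> \<iota>" "z \<circ> \<iota>" "y \<circ> \<iota>" "z \<circ> \<iota>"]
    by (simp add: l2_ip_def distrib_right)
  moreover have "ip ?H (c \<odot>\<^bsub>?H\<^esub> x) y = c * ip ?H x y" for c x y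
    by (simp add: l2_ip_def mult.assoc infsum_cmult_right')
  moreover have "ip ?H y x = cnj (ip ?H x y)" for x y
    by (simp add: l2_ip_def infsum_cnj[symmetric] mult.commute del: infsum_cnj)
  ultimately show ?thesis
    unfolding complex_hilbert_space_def using module_l2[of \<iota> J] by blast
qed

section \<open>Commuting reflections\<close>

text \<open>Toggling \<open>y\<close> exchanges the two basis vectors in the plane of
  \<open>y\<close>.\<close>

definition flip :: "'y \<Rightarrow> 'y set \<Rightarrow> 'y set"
  where "flip y C = (if y \<in> C then C - {y} else insert y C)"

text \<open>A function on sets is a vector in the tensor product of planes: \<open>C\<close> stands for the basis vector
  that is orthogonal to the vacuum in the coordinates \<open>y \<in> C\<close> and equal to it elsewhere. \<open>reflection r y\<close>
  exchanges the two unit vectors with inner product \<open>r\<close> in the plane of \<open>y\<close>.\<close>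

definition reflection :: "real \<Rightarrow> 'y \<Rightarrow> ('y set \<Rightarrow> complex) \<Rightarrow> 'y set \<Rightarrow> complex"
  where "reflection r y f C =
    of_real (if y \<in> C then - r else r) * f C + of_real (sqrt (1 - r\<^sup>2)) * f (flip y C)"

text \<open>The product of the reflections in the coordinates of a finite set \<open>D\<close>. They
  commute, so the order of the fold is immaterial.\<close>

definition reflections :: "real \<Rightarrow> 'y set \<Rightarrow> ('y set \<Rightarrow> complex) \<Rightarrow> 'y set \<Rightarrow> complex"
  where "reflections r D f = Finite_Set.fold (reflection r) f D"

text \<open>The basis vector of \<open>C\<close>; \<open>delta {}\<close> is the vacuum.\<close>

definition delta :: "'y set \<Rightarrow> 'y set \<Rightarrow> complex"
  where "delta C C' = of_bool (C' = C)"

lemma flip_flip [simp]: "flip y (flip y C) = C"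
  by (auto simp: flip_def)

lemma flip_commute: "flip y (flip z C) = flip z (flip y C)"
  by (auto simp: flip_def)

lemma mem_flip: "z \<in> flip y C \<longleftrightarrow> (if z = y then y \<notin> C else z \<in> C)"
  by (auto simp: flip_def)

lemma finite_flip [simp]: "finite (flip y C) \<longleftrightarrow> finite C"
  by (simp add: flip_def)

lemma bij_flip: "bij_betw (flip y) {C. finite C} {C. finite C}"
  by (rule bij_betw_byWitness[where f' = "flip y"]) auto

lemma reflection_commute: "reflection r y (reflection r z f) = reflection r z (reflection r y f)"
  by (cases "y = z") (auto simp: reflection_def fun_eq_iff mem_flip flip_commute algebra_simps)

interpretation reflections: comp_fun_commute "reflection r" for r
  by standard (simp add: fun_eq_iff reflection_commute comp_def)

lemma reflections_empty [simp]: "reflections r {} f = f"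
  by (simp add: reflections_def)

lemma reflections_insert: 
  "finite D \<Longrightarrow> y \<notin> D \<Longrightarrow> reflections r (insert y D) f = reflection r y (reflections r D f)"
  by (simp add: reflections_def)

lemma sqrt_mult_self:
  assumes "0 \<le> r" "r \<le> 1"
  shows "complex_of_real (sqrt (1 - r\<^sup>2)) * of_real (sqrt (1 - r\<^sup>2)) = 1 - of_real r * of_real r"
proof -
  have "r\<^sup>2 \<le> 1" using assms by (simp add: power_le_one)
  then have "sqrt (1 - r\<^sup>2) * sqrt (1 - r\<^sup>2) = 1 - r * r" by (simp add: power2_eq_square)
  then show ?thesis by (metis of_real_1 of_real_diff of_real_mult)
qed

text \<open>On the pair \<open>C\<close>, \<open>flip y C\<close> the matrix has diagonal entries
  \<open>r\<close> and \<open>- r\<close> and off-diagonal entries \<open>s\<close> with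
  \<open>s * s = 1 - r * r\<close>, so its square is the identity.\<close>

lemma reflection_reflection:
  assumes "0 \<le> r" "r \<le> 1"
  shows "reflection r y (reflection r y f) = f"
proof
  fix C
  define s where "s = complex_of_real (sqrt (1 - r\<^sup>2))"
  \<comment> \<open>The nested form matches the right-associated products that
    \<open>algebra_simps\<close> produces.\<close>
  have s: "s * (s * t) = t - of_real r * (of_real r * t)" for t
    using sqrt_mult_self[OF assms] by (simp add: s_def mult.assoc[symmetric] left_diff_distrib)
  show "reflection r y (reflection r y f) C = f C"
    unfolding reflection_def s_def[symmetric]
    by (cases "y \<in> C") (simp_all add: mem_flip algebra_simps s)
qed

lemma reflections_flip:
  assumes r: "0 \<le> r" "r \<le> 1" and D: "finite D"
  shows "reflection r y (reflections r D f) = reflections r (flip y D) f"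
proof (cases "y \<in> D")
  case True
  then have "reflections r D f = reflection r y (reflections r (D - {y}) f)"
    using reflections_insert[of "D - {y}" y r f] D by (simp add: insert_absorb)
  then show ?thesis using True by (simp add: reflection_reflection[OF r] flip_def)
next
  case False
  then show ?thesis using D by (simp add: reflections_insert flip_def)
qed

text \<open>Commuting involutions multiply like finite sets under symmetric difference, because a
  coordinate that occurs twice cancels.\<close>

lemma reflections_mult:
  assumes r: "0 \<le> r" "r \<le> 1" and "finite D" "finite E"
  shows "reflections r D (reflections r E f) = reflections r (sym_diff D E) f"
  using assms(3)
proof (induction D rule: finite_induct)
  case empty
  then show ?case by simp
next
  case (insert y D)
  have "flip y (sym_diff D E) = sym_diff (insert y D) E"
    using insert by (auto simp: flip_def)
  then show ?case
    using insert assms by (simp add: reflections_insert reflections_flip)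
qed

lemma reflections_add:
  "finite D \<Longrightarrow> reflections r D (\<lambda>C. f C + g C) = (\<lambda>C. reflections r D f C + reflections r D g C)"
  by (induction D rule: finite_induct)
    (simp_all add: reflections_insert, simp add: reflection_def fun_eq_iff algebra_simps)

lemma reflections_cmult:
  "finite D \<Longrightarrow> reflections r D (\<lambda>C. c * f C) = (\<lambda>C. c * reflections r D f C)"
  by (induction D rule: finite_induct)
    (simp_all add: reflections_insert, simp add: reflection_def fun_eq_iff algebra_simps)

text \<open>Flips preserve finiteness, so the values at finite sets form an invariant part. Only
  these values are controlled by vectors of the Hilbert space.\<close>

lemma reflections_cong:
  assumes "finite D" "\<And>C. finite C \<Longrightarrow> f C = g C" "finite C"
  shows "reflections r D f C = reflections r D g C"
  using assms(1,3)
  by (induction D arbitrary: C rule: finite_induct)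
    (simp_all add: reflections_insert reflection_def assms(2))

lemma square_summable_reflection:
  assumes "square_summable {C. finite C} f"
  shows "square_summable {C. finite C} (reflection r y f)"
proof -
  have "square_summable {C. finite C} (\<lambda>C. f (flip y C))"
    using assms summable_on_reindex_bij_betw[OF bij_flip, of "\<lambda>C. (cmod (f C))\<^sup>2" y]
    by (simp add: square_summable_def)
  moreover have "square_summable {C. finite C} (\<lambda>C. of_real (if y \<in> C then - r else r) * f C)"
  proof -
    have "(cmod (of_real (if y \<in> C then - r else r) * f C))\<^sup>2 = r\<^sup>2 * (cmod (f C))\<^sup>2" for C
      by (simp add: norm_mult power_mult_distrib)
    then show ?thesis
      using assms unfolding square_summable_def by (simp only: summable_on_cmult_right)
  qed
  ultimately show ?thesis
    unfolding reflection_def by (intro square_summable_add square_summable_cmult)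
qed

text \<open>On each pair \<open>{C, flip y C}\<close> the reflection is an orthogonal \<open>2 \<times> 2\<close> matrix; summing over all
  \<open>C\<close> counts every pair twice.\<close>

lemma l2_ip_reflection:
  assumes r: "0 \<le> r" "r \<le> 1"
    and f: "square_summable {C. finite C} f" and g: "square_summable {C. finite C} g"
  shows "l2_ip {C. finite C} (reflection r y f) (reflection r y g) = l2_ip {C. finite C} f g"
proof -
  let ?J = "{C. finite C}"
  define s where "s = complex_of_real (sqrt (1 - r\<^sup>2))"
  have s: "s * (s * t) = t - of_real r * (of_real r * t)" for t
    using sqrt_mult_self[OF r] by (simp add: s_def mult.assoc[symmetric] left_diff_distrib)
  have cs: "cnj s = s" by (simp add: s_def)
  have double: "2 * infsum h ?J = (\<Sum>\<^sub>\<infinity>C\<in>?J. h C + h (flip y C))" if "h summable_on ?J" for h :: "_ \<Rightarrow> complex"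
  proof -
    have "(\<lambda>C. h (flip y C)) summable_on ?J" "(\<Sum>\<^sub>\<infinity>C\<in>?J. h (flip y C)) = infsum h ?J"
      using summable_on_reindex_bij_betw[OF bij_flip, of h y] that
        infsum_reindex_bij_betw[OF bij_flip, of h y] by simp_all
    then show ?thesis using that by (simp add: infsum_add)
  qed
  have "reflection r y f C * cnj (reflection r y g C) +
      reflection r y f (flip y C) * cnj (reflection r y g (flip y C)) =
      f C * cnj (g C) + f (flip y C) * cnj (g (flip y C))" for C
    unfolding reflection_def s_def[symmetric]
    by (cases "y \<in> C") (simp_all add: mem_flip algebra_simps s cs)
  then have "2 * l2_ip ?J (reflection r y f) (reflection r y g) = 2 * l2_ip ?J f g"
    unfolding l2_ip_def
    by (simp add: double square_summable_prod square_summable_reflection f g)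
  then show ?thesis by simp
qed

lemma reflections_isometry:
  assumes r: "0 \<le> r" "r \<le> 1" and "finite D"
    and f: "square_summable {C. finite C} f" and g: "square_summable {C. finite C} g"
  shows "square_summable {C. finite C} (reflections r D f) \<and>
    square_summable {C. finite C} (reflections r D g) \<and>
    l2_ip {C. finite C} (reflections r D f) (reflections r D g) = l2_ip {C. finite C} f g"
  using assms(3)
  by (induction D rule: finite_induct)
    (simp_all add: f g reflections_insert square_summable_reflection l2_ip_reflection[OF r])

text \<open>The reflection in \<open>y\<close> changes membership of \<open>y\<close> alone, so from
  \<open>C\<close> only sets that differ from it within \<open>D\<close> are reached.\<close>

lemma reflections_delta_support:
  assumes "finite D" "reflections r D (delta C) C' \<noteq> 0"
  shows "sym_diff C C' \<subseteq> D"
  using assms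
proof (induction D arbitrary: C' rule: finite_induct)
  case empty
  then show ?case by (auto simp: delta_def)
next
  case (insert y D)
  then have "reflections r D (delta C) C' \<noteq> 0 \<or> reflections r D (delta C) (flip y C') \<noteq> 0"
    by (auto simp: reflections_insert reflection_def)
  then have "sym_diff C C' \<subseteq> D \<or> sym_diff C (flip y C') \<subseteq> D" using insert.IH by blast
  then show ?case
  proof
    assume a: "sym_diff C (flip y C') \<subseteq> D"
    show ?thesis
    proof
      fix z assume "z \<in> sym_diff C C'"
      then show "z \<in> insert y D" using a mem_flip[of z y C'] by (cases "z = y") auto
    qed
  qed blast
qed

text \<open>The coefficient is a product of entries of 2 by 2 matrices. A coordinate of
  \<open>D\<close> outside \<open>C \<union> C'\<close> contributes the vacuum entry
  \<open>r\<close>, and all other entries have modulus at most 1.\<close>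

lemma reflections_delta_bound:
  assumes r: "0 \<le> r" "r \<le> 1" and D: "finite D"
  shows "cmod (reflections r D (delta C) C') \<le> r ^ card (D - (C \<union> C'))"
  using D
proof (induction D arbitrary: C' rule: finite_induct)
  case empty
  then show ?case by (simp add: delta_def)
next
  case (insert y D)
  let ?g = "reflections r D (delta C)"
  have eq: "reflections r (insert y D) (delta C) C' =
      of_real (if y \<in> C' then - r else r) * ?g C' + of_real (sqrt (1 - r\<^sup>2)) * ?g (flip y C')"
    using insert by (simp add: reflections_insert reflection_def)
  have s: "\<bar>sqrt (1 - r\<^sup>2)\<bar> \<le> 1" using r by (simp add: power_le_one)
  \<comment> \<open>The coordinate \<open>y\<close> has not been reflected yet, so membership of
    \<open>y\<close> is as in \<open>C\<close>. Hence only one of the two terms of the reflection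
    survives.\<close>
  have zero: "?g C'' = 0" if "(y \<in> C'') \<noteq> (y \<in> C)" for C''
    using reflections_delta_support[OF \<open>finite D\<close>, of r C C''] that \<open>y \<notin> D\<close> by auto
  show ?case
  proof (cases "(y \<in> C') = (y \<in> C)")
    case True
    then have "?g (flip y C') = 0" by (intro zero) (simp add: mem_flip)
    then have n: "cmod (reflections r (insert y D) (delta C) C') = r * cmod (?g C')"
      using r unfolding eq by (simp add: norm_mult)
    show ?thesis
    proof (cases "y \<in> C")
      case True
      then have "insert y D - (C \<union> C') = D - (C \<union> C')" by auto
      moreover have "r * cmod (?g C') \<le> 1 * cmod (?g C')" using r by (intro mult_right_mono) auto
      ultimately show ?thesis using insert.IH[of C'] unfolding n by simp
    next
      case False
      with \<open>(y \<in> C') = (y \<in> C)\<close> have "insert y D - (C \<union> C') = insert y (D - (C \<union> C'))" by auto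
      then have "card (insert y D - (C \<union> C')) = Suc (card (D - (C \<union> C')))" using insert by simp
      then show ?thesis unfolding n using r mult_left_mono[OF insert.IH[of C'] r(1)] by simp
    qed
  next
    case False
    then have "?g C' = 0" by (rule zero)
    then have "cmod (reflections r (insert y D) (delta C) C') = \<bar>sqrt (1 - r\<^sup>2)\<bar> * cmod (?g (flip y C'))"
      unfolding eq by (simp add: norm_mult)
    also have "\<dots> \<le> 1 * cmod (?g (flip y C'))" using s by (intro mult_right_mono) auto
    also have "\<dots> \<le> r ^ card (D - (C \<union> flip y C'))" using insert.IH[of "flip y C'"] by simp
    also have "D - (C \<union> flip y C') = insert y D - (C \<union> C')"
      using False \<open>y \<notin> D\<close> by (auto simp: flip_def)
    finally show ?thesis .
  qed
qed

text \<open>Each reflected coordinate contributes the inner product \<open>r\<close> of its two unit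
  vectors.\<close>

lemma reflections_vacuum:
  assumes "finite D"
  shows "reflections r D (delta {}) {} = of_real (r ^ card D)"
  using assms
proof (induction D rule: finite_induct)
  case (insert y D)
  have "reflections r D (delta {}) (flip y {}) = 0"
    using reflections_delta_support[OF \<open>finite D\<close>, of r "{}" "flip y {}"] insert by (auto simp: flip_def)
  then show ?case using insert by (simp add: reflections_insert reflection_def)
qed (simp add: delta_def)

lemma square_summable_delta: "square_summable J (delta C)"
proof -
  let ?h = "\<lambda>C'. (cmod (delta C C'))\<^sup>2"
  have "?h summable_on (J \<inter> {C}) \<longleftrightarrow> ?h summable_on J"
    by (rule summable_on_cong_neutral) (auto simp: delta_def)
  then show ?thesis by (simp add: square_summable_def)
qed

lemma l2_ip_delta:
  assumes "C \<in> J"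
  shows "l2_ip J f (delta C) = f C"
proof -
  have "l2_ip J f (delta C) = (\<Sum>\<^sub>\<infinity>C'\<in>{C}. f C' * cnj (delta C C'))"
    unfolding l2_ip_def by (rule infsum_cong_neutral) (use assms in \<open>auto simp: delta_def\<close>)
  then show ?thesis by (simp add: delta_def)
qed

lemma l2_truncation:
  assumes f: "square_summable J f" and e: "e > 0"
  obtains S where "finite S" "S \<subseteq> J" "l2_norm J (\<lambda>j. if j \<in> S then 0 else f j) < e"
proof -
  let ?h = "\<lambda>j. (cmod (f j))\<^sup>2"
  have sm: "?h summable_on J" using f by (simp add: square_summable_def)
  obtain S where S: "finite S" "S \<subseteq> J" "dist (sum ?h S) (infsum ?h J) \<le> e\<^sup>2 / 2"
    \<comment> \<open>Half of the square of \<open>e\<close> leaves room for the strict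
      inequality.\<close>
    using infsum_finite_approximation[OF sm, of "e\<^sup>2 / 2"] e by auto
  have "(\<Sum>\<^sub>\<infinity>j\<in>J. (cmod (if j \<in> S then 0 else f j))\<^sup>2) = infsum ?h (J - S)"
    by (rule infsum_cong_neutral) auto
  also have "\<dots> = infsum ?h J - infsum ?h S"
    by (rule infsum_Diff) (use S sm in \<open>auto\<close>)
  also have "\<dots> \<le> e\<^sup>2 / 2" using S(3) unfolding dist_real_def infsum_finite[OF S(1)] by linarith
  also have "\<dots> < e\<^sup>2" using e by simp
  finally have "l2_norm J (\<lambda>j. if j \<in> S then 0 else f j) < e"
    unfolding l2_norm_def using e by (intro real_less_lsqrt) auto
  with S show thesis by (intro that)
qed

section \<open>The unitary representation of a commensurating action\<close>

context commensurating_action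
begin

definition defect :: "'a \<Rightarrow> nat set"
  where "defect g = sym_diff (\<phi> g ` B) B"

definition twist :: "real \<Rightarrow> 'a \<Rightarrow> (nat set \<Rightarrow> complex) \<Rightarrow> nat set \<Rightarrow> complex"
  where "twist r g f = reflections r (defect g) (\<lambda>C. f (\<phi> (inv g) ` C))"

lemma inj_action: "g \<in> carrier G \<Longrightarrow> inj (\<phi> g)"
  using bij_action by (simp add: bij_def)

lemma image_action_mult:
  "g \<in> carrier G \<Longrightarrow> h \<in> carrier G \<Longrightarrow> \<phi> (g \<otimes> h) ` C = \<phi> g ` \<phi> h ` C"
  by (auto simp: act_mult image_image)

lemma image_action_inv:
  assumes "g \<in> carrier G"
  shows "\<phi> (inv g) ` \<phi> g ` C = C" "\<phi> g ` \<phi> (inv g) ` C = C"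
  using assms by (simp_all add: image_image act_inv)

lemma bij_image_action:
  "g \<in> carrier G \<Longrightarrow> bij_betw (\<lambda>C. \<phi> g ` C) {C. finite C} {C. finite C}"
  by (rule bij_betw_byWitness[where f' = "\<lambda>C. \<phi> (inv g) ` C"])
    (auto simp: image_action_inv)

lemma finite_defect': "g \<in> carrier G \<Longrightarrow> finite (defect g)"
  using finite_defect by (simp add: defect_def)

text \<open>The cocycle identity in the group of sets under symmetric difference: the translate of
  \<open>B\<close> by \<open>g\<close> occurs twice and cancels.\<close>

lemma defect_mult:
  assumes "g \<in> carrier G" "h \<in> carrier G"
  shows "defect (g \<otimes> h) = sym_diff (defect g) (\<phi> g ` defect h)"
proof -
  have "\<phi> g ` defect h = sym_diff (\<phi> g ` \<phi> h ` B) (\<phi> g ` B)"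
    using inj_action[OF assms(1)] by (simp add: defect_def image_Un image_set_diff)
  then show ?thesis by (auto simp: defect_def image_action_mult[OF assms])
qed

text \<open>Permuting coordinates by \<open>g\<close> conjugates the reflection in \<open>y\<close>
  into the reflection in \<open>\<phi> g y\<close>.\<close>

lemma translate_reflections:
  assumes g: "g \<in> carrier G" and "finite D"
  shows "reflections r D f (\<phi> (inv g) ` C) = reflections r (\<phi> g ` D) (\<lambda>C. f (\<phi> (inv g) ` C)) C"
  using assms(2)
proof (induction D arbitrary: C rule: finite_induct)
  case (insert y D)
  have "flip y (\<phi> (inv g) ` C) = \<phi> (inv g) ` flip (\<phi> g y) C"
    using g inj_action[of "inv g"] act_inv[OF g]
    by (auto simp: flip_def image_set_diff image_iff) 
  moreover have "y \<in> \<phi> (inv g) ` C \<longleftrightarrow> \<phi> g y \<in> C"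
    using mem_image_action[of "inv g" y C] g by simp
  moreover have "\<phi> g y \<notin> \<phi> g ` D" using insert inj_action[OF g] by (simp add: inj_image_mem_iff)
  ultimately show ?case using insert by (simp add: reflections_insert reflection_def)
qed simp

text \<open>Move the permutation of \<open>g\<close> past the reflections of \<open>h\<close>. The
  two products of reflections then merge by \<open>reflections_mult\<close>, and the cocycle
  identity recognizes the result.\<close>

lemma twist_mult:
  assumes r: "0 \<le> r" "r \<le> 1" and g: "g \<in> carrier G" and h: "h \<in> carrier G"
  shows "twist r (g \<otimes> h) f = twist r g (twist r h f)"
proof -
  have "twist r g (twist r h f) = reflections r (defect g) (\<lambda>C.
      reflections r (\<phi> g ` defect h) (\<lambda>C. f (\<phi> (inv h) ` \<phi> (inv g) ` C)) C)"
    by (simp add: twist_def translate_reflections g finite_defect' h)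
  also have "\<dots> = reflections r (defect (g \<otimes> h)) (\<lambda>C. f (\<phi> (inv h) ` \<phi> (inv g) ` C))"
    using reflections_mult[OF r, of "defect g" "\<phi> g ` defect h"] g h
    by (simp add: finite_defect' defect_mult)
  finally show ?thesis
    using g h by (simp add: twist_def G.inv_mult_group image_action_mult)
qed

lemma twist_one: "twist r \<one> f = f"
  by (simp add: twist_def defect_def act_one)

lemma twist_add:
  "g \<in> carrier G \<Longrightarrow> twist r g (\<lambda>C. f C + f' C) = (\<lambda>C. twist r g f C + twist r g f' C)"
  by (simp add: twist_def reflections_add finite_defect')

lemma twist_cmult: "g \<in> carrier G \<Longrightarrow> twist r g (\<lambda>C. c * f C) = (\<lambda>C. c * twist r g f C)"
  by (simp add: twist_def reflections_cmult finite_defect')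

lemma twist_cong:
  assumes "g \<in> carrier G" "\<And>C. finite C \<Longrightarrow> f C = f' C" "finite C"
  shows "twist r g f C = twist r g f' C"
  unfolding twist_def by (intro reflections_cong) (use assms finite_defect' in auto)

lemma twist_isometry:
  assumes r: "0 \<le> r" "r \<le> 1" and g: "g \<in> carrier G"
    and f: "square_summable {C. finite C} f" and f': "square_summable {C. finite C} f'"
  shows "square_summable {C. finite C} (twist r g f)"
    "l2_ip {C. finite C} (twist r g f) (twist r g f') = l2_ip {C. finite C} f f'"
proof -
  let ?J = "{C :: nat set. finite C}"
  have b: "bij_betw (\<lambda>C. \<phi> (inv g) ` C) ?J ?J" using g by (intro bij_image_action) simp
  have s: "square_summable ?J (\<lambda>C. f (\<phi> (inv g) ` C))" if "square_summable ?J f" for f :: "_ \<Rightarrow> complex"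
    using that summable_on_reindex_bij_betw[OF b, of "\<lambda>C. (cmod (f C))\<^sup>2"]
    by (simp add: square_summable_def)
  have "l2_ip ?J (\<lambda>C. f (\<phi> (inv g) ` C)) (\<lambda>C. f' (\<phi> (inv g) ` C)) = l2_ip ?J f f'"
    using infsum_reindex_bij_betw[OF b, of "\<lambda>C. f C * cnj (f' C)"] by (simp add: l2_ip_def)
  with reflections_isometry[OF r finite_defect'[OF g] s[OF f] s[OF f']]
  show "square_summable ?J (twist r g f)" "l2_ip ?J (twist r g f) (twist r g f') = l2_ip ?J f f'"
    by (simp_all add: twist_def)
qed

lemma l2_norm_twist:
  assumes "0 \<le> r" "r \<le> 1" "g \<in> carrier G" "square_summable {C. finite C} f"
  shows "l2_norm {C. finite C} (twist r g f) = l2_norm {C. finite C} f"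
proof -
  have "complex_of_real ((l2_norm {C. finite C} (twist r g f))\<^sup>2) = of_real ((l2_norm {C. finite C} f)\<^sup>2)"
    using twist_isometry[OF assms assms(4)] assms(4) by (simp add: l2_ip_self[symmetric] del: of_real_power)
  then have "(l2_norm {C. finite C} (twist r g f))\<^sup>2 = (l2_norm {C. finite C} f)\<^sup>2"
    using of_real_eq_iff by blast
  then show ?thesis by (simp add: l2_norm_nonneg power2_eq_iff_nonneg)
qed

lemma twist_delta:
  assumes "g \<in> carrier G"
  shows "twist r g (delta C) = reflections r (defect g) (delta (\<phi> g ` C))"
proof -
  have "\<phi> (inv g) ` C' = C \<longleftrightarrow> C' = \<phi> g ` C" for C'
    using image_action_inv[OF assms] by metis
  then have "(\<lambda>C'. delta C (\<phi> (inv g) ` C')) = delta (\<phi> g ` C)"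
    by (simp add: delta_def fun_eq_iff)
  then show ?thesis by (simp add: twist_def)
qed

text \<open>At most \<open>card C + card C'\<close> coordinates of the defect meet the translate of
  \<open>C\<close> or \<open>C'\<close>, so at least \<open>n\<close> factors \<open>r\<close>
  remain.\<close>

lemma twist_delta_bound:
  assumes r: "0 \<le> r" "r \<le> 1" and g: "g \<in> carrier G" and C: "finite C" "finite C'"
    and n: "n + card C + card C' \<le> card (defect g)"
  shows "cmod (twist r g (delta C) C') \<le> r ^ n"
proof -
  have "card (defect g) \<le> card ((defect g - (\<phi> g ` C \<union> C')) \<union> (\<phi> g ` C \<union> C'))"
    using C finite_defect'[OF g] by (intro card_mono) auto
  also have "\<dots> \<le> card (defect g - (\<phi> g ` C \<union> C')) + (card (\<phi> g ` C) + card C')"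
    using card_Un_le[of "defect g - (\<phi> g ` C \<union> C')" "\<phi> g ` C \<union> C'"] card_Un_le[of "\<phi> g ` C" C'] by linarith
  also have "card (\<phi> g ` C) = card C" using inj_action[OF g] by (intro card_image) (simp add: inj_on_def)
  finally have "n \<le> card (defect g - (\<phi> g ` C \<union> C'))" using n by linarith
  then have "r ^ card (defect g - (\<phi> g ` C \<union> C')) \<le> r ^ n" using r by (intro power_decreasing) auto
  with reflections_delta_bound[OF r finite_defect'[OF g], of "\<phi> g ` C" C']
  show ?thesis by (simp add: twist_delta[OF g])
qed

lemma twist_sum_delta:
  assumes g: "g \<in> carrier G" and "finite S"
  shows "twist r g (\<lambda>C. if C \<in> S then f C else 0) C' = (\<Sum>C\<in>S. f C * twist r g (delta C) C')"
  using assms(2)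
proof (induction S rule: finite_induct)
  case empty
  show ?case using twist_cmult[OF g, of r 0 "\<lambda>_. 0"] by simp
next
  case (insert D S)
  have "(\<lambda>C. if C \<in> insert D S then f C else 0) = (\<lambda>C. f D * delta D C + (if C \<in> S then f C else 0))"
    using insert by (auto simp: delta_def fun_eq_iff)
  then show ?case using insert by (simp add: twist_add[OF g] twist_cmult[OF g])
qed

text \<open>The matrix coefficients of \<open>g\<close> tend to \<open>0\<close> as the defect of \<open>g\<close> grows.\<close>

lemma twist_no_invariant:
  assumes r: "0 \<le> r" "r < 1" and f: "square_summable {C. finite C} f"
    and inv: "\<And>g C. g \<in> carrier G \<Longrightarrow> finite C \<Longrightarrow> twist r g f C = f C" and C0: "finite C0"
  shows "f C0 = 0"
proof (rule ccontr)
  assume nz: "f C0 \<noteq> 0"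
  let ?J = "{C :: nat set. finite C}"
  define a where "a = cmod (f C0)"
  have a: "a > 0" using nz by (simp add: a_def)
  \<comment> \<open>The tail beyond \<open>S\<close> has norm below \<open>a / 2\<close>, and
    \<open>twist\<close> preserves this norm.\<close>
  obtain S where S: "finite S" "S \<subseteq> ?J" "l2_norm ?J (\<lambda>C. if C \<in> S then 0 else f C) < a / 2"
    using l2_truncation[OF f, of "a / 2"] a by auto
  define f1 where "f1 = (\<lambda>C. if C \<in> S then f C else 0)"
  define f2 where "f2 = (\<lambda>C. if C \<in> S then 0 else f C)"
  define M where "M = (\<Sum>C\<in>S. cmod (f C))"
  have M0: "0 \<le> M" by (simp add: M_def sum_nonneg)
  have "(\<lambda>n. M * r ^ n) \<longlonglongrightarrow> M * 0" using r by (intro tendsto_mult LIMSEQ_realpow_zero) auto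
  then have "\<forall>\<^sub>F n in sequentially. M * r ^ n < a / 2"
    using a by (intro order_tendstoD) auto
  then obtain n where n: "M * r ^ n < a / 2" by (auto simp: eventually_sequentially)
  \<comment> \<open>The sum of all cardinalities over \<open>S\<close> dominates each of them, so
    the bound \<open>r ^ n\<close> applies to every \<open>C \<in> S\<close> with the same
    \<open>g\<close>.\<close>
  obtain g where g: "g \<in> carrier G" and card: "n + (\<Sum>C\<in>S. card C) + card C0 \<le> card (defect g)"
    using unbounded_defect[of "n + (\<Sum>C\<in>S. card C) + card C0"] by (auto simp: defect_def)
  have r': "0 \<le> r" "r \<le> 1" using r by auto
  have f2: "square_summable ?J f2"
    using f unfolding square_summable_def f2_def
    by (rule summable_on_comparison_test) auto
  have "f = (\<lambda>C. f1 C + f2 C)" by (auto simp: f1_def f2_def)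
  then have "f C0 = twist r g f1 C0 + twist r g f2 C0"
    using twist_add[OF g, of r f1 f2] inv[OF g C0] by metis
  then have "a \<le> cmod (twist r g f1 C0) + cmod (twist r g f2 C0)"
    unfolding a_def by (metis norm_triangle_ineq)
  also have "cmod (twist r g f2 C0) < a / 2"
    using norm_le_l2_norm[OF twist_isometry(1)[OF r' g f2 f2], of C0] l2_norm_twist[OF r' g f2] S C0
    by (simp add: f2_def)
  also have "cmod (twist r g f1 C0) \<le> (\<Sum>C\<in>S. cmod (f C) * r ^ n)"
    unfolding f1_def twist_sum_delta[OF g S(1)]
  proof (rule sum_norm_le)
    fix C assume C: "C \<in> S"
    have "card C \<le> (\<Sum>C\<in>S. card C)" using C S by (intro member_le_sum) auto
    then have "cmod (twist r g (delta C) C0) \<le> r ^ n"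
      using C S card by (intro twist_delta_bound[OF r' g _ C0]) auto
    then show "cmod (f C * twist r g (delta C) C0) \<le> cmod (f C) * r ^ n"
      by (simp add: norm_mult mult_left_mono)
  qed
  also have "\<dots> = M * r ^ n" by (simp add: M_def sum_distrib_right)
  finally show False using n by simp
qed

section \<open>The Hilbert space representation and failure of property (T)\<close>

definition twist_rep :: "real \<Rightarrow> (nat set \<Rightarrow> 'i) \<Rightarrow> 'a \<Rightarrow> ('i \<Rightarrow> complex) \<Rightarrow> 'i \<Rightarrow> complex"
  where "twist_rep r \<iota> g = (\<lambda>x\<in>carrier (l2_module \<iota> {C. finite C}).
    l2_embed \<iota> {C. finite C} (twist r g (x \<circ> \<iota>)))"

lemma twist_rep_apply:
  assumes "inj \<iota>" "x \<in> carrier (l2_module \<iota> {C. finite C})" "finite C"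
  shows "twist_rep r \<iota> g x (\<iota> C) = twist r g (x \<circ> \<iota>) C"
  using assms l2_embed_apply[of \<iota> "{C. finite C}" C]
  by (simp add: twist_rep_def inj_on_def del: l2_module_simps)

lemma twist_rep_closed:
  assumes r: "0 \<le> r" "r \<le> 1" and \<iota>: "inj \<iota>" and g: "g \<in> carrier G"
    and x: "x \<in> carrier (l2_module \<iota> {C. finite C})"
  shows "twist_rep r \<iota> g x \<in> carrier (l2_module \<iota> {C. finite C})"
proof -
  have "square_summable {C. finite C} (x \<circ> \<iota>)" using x by simp
  from twist_isometry(1)[OF r g this this] show ?thesis
    using x \<iota> l2_embed_carrier[of \<iota> "{C. finite C}"]
    by (simp add: twist_rep_def inj_on_def del: l2_module_simps)
qed

text \<open>Vectors are determined by their values at \<open>\<iota> C\<close> for finite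
  \<open>C\<close>. There the representation is \<open>twist\<close>, so every identity reduces to
  the corresponding one for functions on finite sets.\<close>

lemma unitary_twist_rep:
  assumes r: "0 \<le> r" "r \<le> 1" and \<iota>: "inj \<iota>"
  shows "unitary_representation G (l2_module \<iota> {C. finite C}) (twist_rep r \<iota>)"
proof -
  let ?J = "{C :: nat set. finite C}" let ?H = "l2_module \<iota> ?J"
  note closed = twist_rep_closed[OF r \<iota>]
  note app = twist_rep_apply[OF \<iota>]
  have injJ: "inj_on \<iota> ?J" using \<iota> by (simp add: inj_on_def)
  have act: "group_action G (carrier ?H) (twist_rep r \<iota>)"
  proof (rule group_actionI)
    show "group G" by (rule G.is_group)
    show "twist_rep r \<iota> \<one> x = x" if x: "x \<in> carrier ?H" for x
      by (rule l2_eqI[OF closed[OF G.one_closed x] x]) (simp add: app[OF x] twist_one)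
    show "twist_rep r \<iota> (g \<otimes> h) x = twist_rep r \<iota> g (twist_rep r \<iota> h x)"
      if g: "g \<in> carrier G" and h: "h \<in> carrier G" and x: "x \<in> carrier ?H" for g h x
    proof (rule l2_eqI[OF closed[OF G.m_closed[OF g h] x] closed[OF g closed[OF h x]]])
      fix C assume "C \<in> ?J"
      then have C: "finite C" by simp
      have "twist_rep r \<iota> g (twist_rep r \<iota> h x) (\<iota> C) = twist r g (twist_rep r \<iota> h x \<circ> \<iota>) C"
        by (rule app[OF closed[OF h x] C])
      also have "\<dots> = twist r g (twist r h (x \<circ> \<iota>)) C"
        by (rule twist_cong[OF g _ C]) (simp add: app[OF x])
      finally show "twist_rep r \<iota> (g \<otimes> h) x (\<iota> C) = twist_rep r \<iota> g (twist_rep r \<iota> h x) (\<iota> C)"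
        by (simp add: app[OF x C] twist_mult[OF r g h])
    qed
    show "twist_rep r \<iota> g x \<in> carrier ?H" if "g \<in> carrier G" "x \<in> carrier ?H" for g x
      using that by (rule closed)
    show "twist_rep r \<iota> g \<in> extensional (carrier ?H)" for g
      unfolding twist_rep_def by (rule restrict_extensional)
  qed
  have add: "twist_rep r \<iota> g (x \<oplus>\<^bsub>?H\<^esub> y) = twist_rep r \<iota> g x \<oplus>\<^bsub>?H\<^esub> twist_rep r \<iota> g y"
    if g: "g \<in> carrier G" and x: "x \<in> carrier ?H" and y: "y \<in> carrier ?H" for g x y
  proof -
    interpret abelian_group ?H by (rule abelian_group_l2)
    note xy = a_closed[OF x y]
    show ?thesis
    proof (rule l2_eqI[OF closed[OF g xy] a_closed[OF closed[OF g x] closed[OF g y]]])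
      fix C assume "C \<in> ?J"
      then have C: "finite C" by simp
      show "twist_rep r \<iota> g (x \<oplus>\<^bsub>?H\<^esub> y) (\<iota> C) = (twist_rep r \<iota> g x \<oplus>\<^bsub>?H\<^esub> twist_rep r \<iota> g y) (\<iota> C)"
        using app[OF xy C, of r g] app[OF x C, of r g] app[OF y C, of r g]
          twist_add[OF g, of r "x \<circ> \<iota>" "y \<circ> \<iota>"] by (simp add: comp_def)
    qed
  qed
  have smult: "twist_rep r \<iota> g (c \<odot>\<^bsub>?H\<^esub> x) = c \<odot>\<^bsub>?H\<^esub> twist_rep r \<iota> g x"
    if g: "g \<in> carrier G" and x: "x \<in> carrier ?H" for g c x
  proof -
    interpret module complex_ring ?H by (rule module_l2)
    have c: "c \<in> carrier complex_ring" by (simp add: complex_ring_def)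
    note cx = smult_closed[OF c x]
    show ?thesis
    proof (rule l2_eqI[OF closed[OF g cx] smult_closed[OF c closed[OF g x]]])
      fix C assume "C \<in> ?J"
      then have C: "finite C" by simp
      show "twist_rep r \<iota> g (c \<odot>\<^bsub>?H\<^esub> x) (\<iota> C) = (c \<odot>\<^bsub>?H\<^esub> twist_rep r \<iota> g x) (\<iota> C)"
        using app[OF cx C, of r g] app[OF x C, of r g] twist_cmult[OF g, of r c "x \<circ> \<iota>"]
        by (simp add: comp_def)
    qed
  qed
  have ip: "ip ?H (twist_rep r \<iota> g x) (twist_rep r \<iota> g y) = ip ?H x y"
    if g: "g \<in> carrier G" and x: "x \<in> carrier ?H" and y: "y \<in> carrier ?H" for g x y
  proof -
    have "ip ?H (twist_rep r \<iota> g x) (twist_rep r \<iota> g y) =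
        l2_ip ?J (twist r g (x \<circ> \<iota>)) (twist r g (y \<circ> \<iota>))"
      by (simp, rule l2_ip_cong) (use app[OF x] app[OF y] in simp_all)
    also have "\<dots> = ip ?H x y" using twist_isometry(2)[OF r g, of "x \<circ> \<iota>" "y \<circ> \<iota>"] x y by simp
    finally show ?thesis .
  qed
  show ?thesis
    unfolding unitary_representation_def
    using complex_hilbert_space_l2[OF injJ] act add smult ip by blast
qed

text \<open>Expand the square: the vacuum and its image are unit vectors with inner product
  \<open>r ^ card (defect g)\<close>.\<close>

lemma vacuum_displacement:
  assumes r: "0 \<le> r" "r \<le> 1" and g: "g \<in> carrier G"
  shows "(l2_norm {C. finite C} (\<lambda>C. twist r g (delta {}) C - delta {} C))\<^sup>2 =
    2 - 2 * r ^ card (defect g)"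
proof -
  let ?J = "{C :: nat set. finite C}"
  let ?e = "delta {} :: nat set \<Rightarrow> complex"
  let ?t = "twist r g ?e"
  note e = square_summable_delta[of ?J "{}"]
  note t = twist_isometry(1)[OF r g e e]
  note p = square_summable_prod
  have te: "l2_ip ?J ?t ?e = of_real (r ^ card (defect g))"
    by (simp add: l2_ip_delta twist_delta[OF g] reflections_vacuum finite_defect'[OF g])
  have "l2_ip ?J ?e ?t = cnj (l2_ip ?J ?t ?e)"
    by (simp add: l2_ip_def infsum_cnj[symmetric] mult.commute del: infsum_cnj)
  then have et: "l2_ip ?J ?e ?t = of_real (r ^ card (defect g))" by (simp add: te)
  have ee: "l2_ip ?J ?e ?e = 1" by (simp add: l2_ip_delta) (simp add: delta_def)
  have tt: "l2_ip ?J ?t ?t = 1" using twist_isometry(2)[OF r g e e] ee by simp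
  have "complex_of_real ((l2_norm ?J (\<lambda>C. ?t C - ?e C))\<^sup>2) = l2_ip ?J (\<lambda>C. ?t C - ?e C) (\<lambda>C. ?t C - ?e C)"
    by (rule l2_ip_self[symmetric, OF square_summable_diff[OF t e]])
  also have "\<dots> = (\<Sum>\<^sub>\<infinity>C\<in>?J. (?t C * cnj (?t C) + ?e C * cnj (?e C)) +
      (- 1) * (?t C * cnj (?e C) + ?e C * cnj (?t C)))"
    unfolding l2_ip_def by (intro infsum_cong) (simp add: algebra_simps)
  also have "\<dots> = (l2_ip ?J ?t ?t + l2_ip ?J ?e ?e) + (- 1) * (l2_ip ?J ?t ?e + l2_ip ?J ?e ?t)"
    unfolding l2_ip_def
    by (simp only: infsum_add infsum_cmult_right' summable_on_add summable_on_cmult_right p t e)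
  also have "\<dots> = of_real (2 - 2 * r ^ card (defect g))" by (simp add: tt ee te et)
  finally show ?thesis using of_real_eq_iff by blast
qed

text \<open>The vacuum is almost invariant for \<open>r\<close> close to 1, yet no nonzero vector is
  invariant. The injection realizes the representation in the vector type over which
  \<open>property_T\<close> quantifies.\<close>

lemma not_property_T:
  assumes "\<exists>\<iota> :: nat set \<Rightarrow> 'a \<times> nat. inj \<iota>"
  shows "\<not> property_T G"
proof
  assume "property_T G"
  then obtain Q \<epsilon> where Q: "Q \<subseteq> carrier G" "finite Q" and \<epsilon>: "\<epsilon> > 0"
    and T: "\<And>(H :: ('a \<times> nat \<Rightarrow> complex) inner_module) \<pi>. unitary_representation G H \<pi> \<Longrightarrow>
        (\<exists>x\<in>carrier H. x \<noteq> \<zero>\<^bsub>H\<^esub> \<and> (\<forall>g\<in>Q. hdist H (\<pi> g x) x < \<epsilon> * hnorm H x)) \<Longrightarrow>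
        (\<exists>x\<in>carrier H. x \<noteq> \<zero>\<^bsub>H\<^esub> \<and> (\<forall>g\<in>carrier G. \<pi> g x = x))"
    unfolding property_T_def by blast
  from assms obtain \<iota> :: "nat set \<Rightarrow> 'a \<times> nat" where \<iota>: "inj \<iota>" by blast
  let ?J = "{C :: nat set. finite C}" let ?H = "l2_module \<iota> ?J"
  have injJ: "inj_on \<iota> ?J" using \<iota> by (simp add: inj_on_def)
  define M where "M = (\<Sum>g\<in>Q. card (defect g))"
  \<comment> \<open>By Bernoulli's inequality the squared displacement of the vacuum is at most
    \<open>2 * M * \<eta>\<close> on all of \<open>Q\<close>, which this choice keeps below the
    square of \<open>\<epsilon>\<close>. The minimum with 1 ensures \<open>0 \<le> r\<close>, and
    \<open>M + 1\<close> avoids a zero denominator.\<close>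
  define \<eta> where "\<eta> = min 1 (\<epsilon>\<^sup>2 / (4 * (M + 1)))"
  define r where "r = 1 - \<eta>"
  have \<eta>: "0 < \<eta>" "\<eta> \<le> 1" using \<epsilon> by (simp_all add: \<eta>_def)
  then have r: "0 \<le> r" "r \<le> 1" "r < 1" by (simp_all add: r_def)
  have "\<eta> * (4 * (M + 1)) \<le> \<epsilon>\<^sup>2 / (4 * (M + 1)) * (4 * (M + 1))"
    by (intro mult_right_mono) (simp_all add: \<eta>_def)
  then have \<eta>M: "\<eta> * (4 * (M + 1)) \<le> \<epsilon>\<^sup>2" by simp
  have small: "2 - 2 * r ^ card (defect g) < \<epsilon>\<^sup>2" if g: "g \<in> Q" for g
  proof -
    have "card (defect g) \<le> M" unfolding M_def using g Q by (intro member_le_sum) auto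
    then have "r ^ M \<le> r ^ card (defect g)" using r by (intro power_decreasing) auto
    moreover have "1 - M * \<eta> \<le> r ^ M"
      using Bernoulli_inequality[of "- \<eta>" M] \<eta> by (simp add: r_def)
    ultimately have "2 - 2 * r ^ card (defect g) \<le> 2 * M * \<eta>" by linarith
    also have "\<dots> < \<eta> * (4 * (M + 1))" using \<eta> by (simp add: algebra_simps add_pos_nonneg)
    finally show ?thesis using \<eta>M by linarith
  qed
  define x0 where "x0 = l2_embed \<iota> ?J (delta {})"
  have x0: "x0 \<in> carrier ?H"
    unfolding x0_def by (rule l2_embed_carrier[OF injJ square_summable_delta])
  have x0_app: "x0 (\<iota> C) = delta {} C" if "finite C" for C
    using that l2_embed_apply[OF injJ] by (simp add: x0_def)
  have "x0 (\<iota> {}) \<noteq> 0" by (simp add: x0_app delta_def)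
  then have x0_nz: "x0 \<noteq> \<zero>\<^bsub>?H\<^esub>" by auto
  have "l2_norm ?J (x0 \<circ> \<iota>) = l2_norm ?J (delta {})" by (rule l2_norm_cong) (simp add: x0_app)
  moreover have "complex_of_real ((l2_norm ?J (delta {}))\<^sup>2) = 1"
    by (subst l2_ip_self[symmetric, OF square_summable_delta]) (simp add: l2_ip_delta, simp add: delta_def)
  then have "l2_norm ?J (delta {}) = 1"
    using l2_norm_nonneg[of ?J "delta {}"] by (simp add: power2_eq_1_iff flip: of_real_power) 
  ultimately have norm: "hnorm ?H x0 = 1" by (simp add: hnorm_l2[OF x0])
  note rep = unitary_twist_rep[OF r(1,2) \<iota>]
  have "hdist ?H (twist_rep r \<iota> g x0) x0 < \<epsilon> * hnorm ?H x0" if "g \<in> Q" for g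
  proof -
    have g: "g \<in> carrier G" using that Q by auto
    have "hdist ?H (twist_rep r \<iota> g x0) x0 =
        l2_norm ?J (\<lambda>C. twist_rep r \<iota> g x0 (\<iota> C) - x0 (\<iota> C))"
      by (rule hdist_l2[OF twist_rep_closed[OF r(1,2) \<iota> g x0] x0])
    also have "\<dots> = l2_norm ?J (\<lambda>C. twist r g (delta {}) C - delta {} C)"
    proof (rule l2_norm_cong)
      fix C assume "C \<in> ?J"
      then have C: "finite C" by simp
      have "twist r g (x0 \<circ> \<iota>) C = twist r g (delta {}) C"
        by (rule twist_cong[OF g _ C]) (simp add: x0_app)
      then show "twist_rep r \<iota> g x0 (\<iota> C) - x0 (\<iota> C) = twist r g (delta {}) C - delta {} C"
        by (simp add: twist_rep_apply[OF \<iota> x0 C] x0_app[OF C])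
    qed
    finally have "(hdist ?H (twist_rep r \<iota> g x0) x0)\<^sup>2 < \<epsilon>\<^sup>2"
      using vacuum_displacement[OF r(1,2) g] small[OF that] by simp
    then show ?thesis using \<epsilon> norm by (simp add: power_less_imp_less_base)
  qed
  then obtain x where x: "x \<in> carrier ?H" "x \<noteq> \<zero>\<^bsub>?H\<^esub>" "\<And>g. g \<in> carrier G \<Longrightarrow> twist_rep r \<iota> g x = x"
    using T[OF rep] x0 x0_nz by blast
  have "(x \<circ> \<iota>) C = 0" if "finite C" for C
  proof (rule twist_no_invariant[OF r(1,3) _ _ that])
    show "square_summable ?J (x \<circ> \<iota>)" using x(1) by simp
    show "twist r g (x \<circ> \<iota>) C = (x \<circ> \<iota>) C" if "g \<in> carrier G" "finite C" for g C
      using twist_rep_apply[OF \<iota> x(1) that(2), of r g] x(3)[OF that(1)] by simp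
  qed
  then have zero: "x (\<iota> C) = \<zero>\<^bsub>?H\<^esub> (\<iota> C)" if "C \<in> ?J" for C using that by simp
  have "\<zero>\<^bsub>?H\<^esub> \<in> carrier ?H" by (simp add: comp_def)
  with x(1) have "x = \<zero>\<^bsub>?H\<^esub>" using zero by (rule l2_eqI)
  with x(2) show False by simp
qed

end

section \<open>Presented groups\<close>

lemma words_append [simp]: "u @ v \<in> words S \<longleftrightarrow> u \<in> words S \<and> v \<in> words S"
  by (auto simp: words_def)

lemma words_Cons [simp]: "a # v \<in> words S \<longleftrightarrow> fst a \<in> S \<and> v \<in> words S"
  by (cases a) (auto simp: words_def)

lemma words_Nil [simp]: "[] \<in> words S"
  by (simp add: words_def)

lemma pres_eq_words: "pres_eq S R u v \<Longrightarrow> u \<in> words S \<and> v \<in> words S"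
  by (induction rule: pres_eq.induct) auto

lemma pres_eq_append_left: "pres_eq S R u v \<Longrightarrow> a \<in> words S \<Longrightarrow> pres_eq S R (a @ u) (a @ v)"
proof (induction rule: pres_eq.induct)
  case (cancel u v s b)
  then show ?case using pres_eq.cancel[of "a @ u" S v s R b] by simp
next
  case (relator u v r)
  then show ?case using pres_eq.relator[of "a @ u" S v r R] by simp
qed (auto intro: pres_eq.refl pres_eq.sym pres_eq.trans)

lemma pres_eq_append_right: "pres_eq S R u v \<Longrightarrow> a \<in> words S \<Longrightarrow> pres_eq S R (u @ a) (v @ a)"
proof (induction rule: pres_eq.induct)
  case (cancel u v s b)
  then show ?case using pres_eq.cancel[of u S "v @ a" s R b] by simp
next
  case (relator u v r)
  then show ?case using pres_eq.relator[of u S "v @ a" r R] by simp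
qed (auto intro: pres_eq.refl pres_eq.sym pres_eq.trans)

lemma pres_eq_append:
  assumes "pres_eq S R u u'" "pres_eq S R v v'"
  shows "pres_eq S R (u @ v) (u' @ v')"
  using pres_eq_append_right[OF assms(1), of v] pres_eq_append_left[OF assms(2), of u']
    pres_eq_words[OF assms(1)] pres_eq_words[OF assms(2)] by (blast intro: pres_eq.trans)

definition word_class :: "'a set \<Rightarrow> 'a word set \<Rightarrow> 'a word \<Rightarrow> 'a word set"
  where "word_class S R w = {v. pres_eq S R w v}"

lemma word_class_eq_iff:
  assumes "u \<in> words S"
  shows "word_class S R u = word_class S R v \<longleftrightarrow> pres_eq S R u v"
proof
  assume "word_class S R u = word_class S R v"
  then show "pres_eq S R u v"
    using pres_eq.refl[OF assms, of R] by (auto simp: word_class_def intro: pres_eq.sym)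
next
  assume "pres_eq S R u v"
  then show "word_class S R u = word_class S R v"
    by (auto simp: word_class_def intro: pres_eq.sym pres_eq.trans)
qed

lemma carrier_presented_group: "carrier (presented_group S R) = word_class S R ` words S"
  by (auto simp: presented_group_def quotient_def word_class_def)

lemma one_presented_group: "\<one>\<^bsub>presented_group S R\<^esub> = word_class S R []"
  by (simp add: presented_group_def word_class_def)

lemma mult_presented_group:
  assumes "u \<in> words S" "v \<in> words S"
  shows "word_class S R u \<otimes>\<^bsub>presented_group S R\<^esub> word_class S R v = word_class S R (u @ v)"
proof -
  have "(\<exists>u'\<in>word_class S R u. \<exists>v'\<in>word_class S R v. pres_eq S R (u' @ v') w) \<longleftrightarrow>
      pres_eq S R (u @ v) w" for w
    using pres_eq.refl[OF assms(1), of R] pres_eq.refl[OF assms(2), of R]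
    by (auto simp: word_class_def intro: pres_eq.trans pres_eq_append)
  then show ?thesis by (simp add: presented_group_def word_class_def)
qed

lemma word_class_cancel:
  "s \<in> S \<Longrightarrow> word_class S R [(s, b), (s, \<not> b)] = word_class S R []"
  using pres_eq.cancel[of "[]" S "[]" s R b] by (subst word_class_eq_iff) auto

lemma group_presented_group: "group (presented_group S R)"
proof (rule groupI)
  let ?P = "presented_group S R"
  show "x \<otimes>\<^bsub>?P\<^esub> y \<in> carrier ?P" if "x \<in> carrier ?P" "y \<in> carrier ?P" for x y
    using that by (auto simp: carrier_presented_group mult_presented_group)
  show "\<one>\<^bsub>?P\<^esub> \<in> carrier ?P" by (auto simp: carrier_presented_group one_presented_group)
  show "x \<otimes>\<^bsub>?P\<^esub> y \<otimes>\<^bsub>?P\<^esub> z = x \<otimes>\<^bsub>?P\<^esub> (y \<otimes>\<^bsub>?P\<^esub> z)"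
    if "x \<in> carrier ?P" "y \<in> carrier ?P" "z \<in> carrier ?P" for x y z
    using that by (auto simp: carrier_presented_group mult_presented_group)
  show "\<one>\<^bsub>?P\<^esub> \<otimes>\<^bsub>?P\<^esub> x = x" if "x \<in> carrier ?P" for x
    using that by (auto simp: carrier_presented_group one_presented_group mult_presented_group)
  have "\<exists>v\<in>words S. pres_eq S R (v @ w) []" if "w \<in> words S" for w
    using that
  proof (induction w)
    case Nil
    show ?case using pres_eq.refl[of "[]" S R] by (intro bexI[of _ "[]"]) auto
  next
    case (Cons a w)
    obtain s b where a: "a = (s, b)" by (cases a)
    obtain v where v: "v \<in> words S" "pres_eq S R (v @ w) []" using Cons by auto
    \<comment> \<open>If \<open>v\<close> inverts \<open>w\<close>, then \<open>v\<close> followed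
      by the inverse letter of \<open>a\<close> inverts \<open>a # w\<close>. The double negation is
      the form in which \<open>cancel\<close> presents the letter \<open>a\<close>.\<close>
    have "pres_eq S R (v @ [(s, \<not> b), (s, \<not> \<not> b)] @ w) (v @ w)"
      using Cons v a by (intro pres_eq.cancel) auto
    then have "pres_eq S R ((v @ [(s, \<not> b)]) @ a # w) []" using v a by (auto intro: pres_eq.trans)
    moreover have "v @ [(s, \<not> b)] \<in> words S" using v Cons a by simp
    ultimately show ?case by blast
  qed
  then show "\<exists>y\<in>carrier ?P. y \<otimes>\<^bsub>?P\<^esub> x = \<one>\<^bsub>?P\<^esub>" if "x \<in> carrier ?P" for x
    using that by (fastforce simp: carrier_presented_group one_presented_group mult_presented_group
        word_class_eq_iff)
qed

lemma countable_presented_group: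
  assumes "countable S"
  shows "countable (carrier (presented_group S R))"
  using assms unfolding carrier_presented_group words_def by (intro countable_image countable_lists) auto

lemma word_class_of_element:
  assumes "A \<in> carrier (presented_group S R)"
  shows "(SOME w. w \<in> A) \<in> words S" "word_class S R (SOME w. w \<in> A) = A"
proof -
  obtain u where u: "u \<in> words S" "A = word_class S R u"
    using assms by (auto simp: carrier_presented_group)
  then have "u \<in> A" by (simp add: word_class_def pres_eq.refl)
  then have "(SOME w. w \<in> A) \<in> A" by (rule someI)
  then have *: "pres_eq S R u (SOME w. w \<in> A)" by (simp add: u word_class_def)
  then show "(SOME w. w \<in> A) \<in> words S" by (simp add: pres_eq_words)
  show "word_class S R (SOME w. w \<in> A) = A"
    using word_class_eq_iff[OF u(1)] * u(2) by metis
qed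

section \<open>Counting edge crossings\<close>

text \<open>The group \<open>P\<close> provides the Cayley graph; any infinite group with finitely
  many generators serves, and its relators are arbitrary.\<close>

locale cubization =
  fixes S :: "'s set" and R :: "'s word set" and k :: nat and P (structure)
  assumes finite_gens: "finite S" and k: "k > 1" and P_def: "P = presented_group S R"
    and infinite_group: "infinite (carrier P)"
begin

sublocale group P
  unfolding P_def by (rule group_presented_group)

definition cl :: "'s word \<Rightarrow> 's word set"
  where "cl w = word_class S R w"

lemma carrier_P: "carrier P = cl ` words S"
  by (simp add: P_def cl_def carrier_presented_group image_def)

lemma cl_closed [simp]: "w \<in> words S \<Longrightarrow> cl w \<in> carrier P"
  by (simp add: carrier_P)

lemma cl_append: "u \<in> words S \<Longrightarrow> v \<in> words S \<Longrightarrow> cl (u @ v) = cl u \<otimes> cl v"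
  by (simp add: P_def cl_def mult_presented_group)

lemma cl_Nil: "cl [] = \<one>"
  by (simp add: P_def cl_def one_presented_group)

lemma cl_Cons: "fst a \<in> S \<Longrightarrow> w \<in> words S \<Longrightarrow> cl (a # w) = cl [a] \<otimes> cl w"
  using cl_append[of "[a]" w] by simp

lemma cl_letter_inverse:
  assumes "s \<in> S"
  shows "cl [(s, \<not> b)] = inv cl [(s, b)]"
proof -
  have "cl [(s, \<not> b)] \<otimes> cl [(s, \<not> \<not> b)] = \<one>"
    using word_class_cancel[OF assms, of R "\<not> b"] assms cl_append[of "[(s, \<not> b)]" "[(s, \<not> \<not> b)]"]
    by (simp add: cl_Nil[symmetric]) (simp add: cl_def)
  then show ?thesis using assms inv_equality[of "cl [(s, \<not> b)]" "cl [(s, b)]"] by simp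
qed

text \<open>The edge \<open>(g, t)\<close> of the Cayley graph leads from \<open>g\<close> to \<open>g \<otimes> cl [(t, True)]\<close>; the path of a
  word starts at \<open>\<one>\<close>, and \<open>chain w g t\<close> counts with sign how often it crosses \<open>(g, t)\<close>.\<close>

fun letter_chain :: "'s \<times> bool \<Rightarrow> 's word set \<Rightarrow> 's \<Rightarrow> int"
  where "letter_chain (s, b) g t =
    (if b then of_bool (t = s \<and> g = \<one>) else - of_bool (t = s \<and> g = cl [(s, False)]))"

primrec chain :: "'s word \<Rightarrow> 's word set \<Rightarrow> 's \<Rightarrow> int"
  where
    "chain [] g t = 0"
  | "chain (a # w) g t = letter_chain a g t + chain w (inv (cl [a]) \<otimes> g) t"

text \<open>The path of \<open>u @ v\<close> is the path of \<open>u\<close> followed by that of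
  \<open>v\<close> translated by \<open>cl u\<close>, so the counts form a cocycle.\<close>

lemma chain_append:
  assumes "u \<in> words S" "v \<in> words S" "g \<in> carrier P"
  shows "chain (u @ v) g t = chain u g t + chain v (inv (cl u) \<otimes> g) t"
  using assms
proof (induction u arbitrary: g)
  case (Cons a u)
  then show ?case by (simp add: cl_Cons[of a u] inv_mult_group m_assoc)
qed (simp add: cl_Nil)

text \<open>A skew product: \<open>w\<close> translates the edges and shifts the \<int>/k coordinate
  by the number of crossings of the image edge. The cocycle law of \<open>chain\<close> makes it
  compatible with concatenation.\<close>

definition act :: "'s word \<Rightarrow> 's word set \<times> 's \<times> int \<Rightarrow> 's word set \<times> 's \<times> int"
  where "act w = (\<lambda>(g, t, i)\<in>carrier P \<times> S \<times> {0..<int k}.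
    (cl w \<otimes> g, t, (i + chain w (cl w \<otimes> g) t) mod int k))"

lemma act_extensional: "act w \<in> extensional (carrier P \<times> S \<times> {0..<int k})"
  unfolding act_def by (rule restrict_extensional)

lemma act_closed:
  "w \<in> words S \<Longrightarrow> y \<in> carrier P \<times> S \<times> {0..<int k} \<Longrightarrow> act w y \<in> carrier P \<times> S \<times> {0..<int k}"
  using k by (auto simp: act_def)

lemma act_append:
  assumes u: "u \<in> words S" and v: "v \<in> words S" and y: "y \<in> carrier P \<times> S \<times> {0..<int k}"
  shows "act (u @ v) y = act u (act v y)"
proof -
  obtain g t i where y: "y = (g, t, i)" "g \<in> carrier P" "t \<in> S" "i \<in> {0..<int k}"
    using y by (cases y) auto
  have "inv cl u \<otimes> (cl u \<otimes> (cl v \<otimes> g)) = cl v \<otimes> g"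
    using u v y by (simp add: m_assoc[symmetric])
  then have "chain (u @ v) (cl u \<otimes> (cl v \<otimes> g)) t = chain u (cl u \<otimes> (cl v \<otimes> g)) t + chain v (cl v \<otimes> g) t"
    using u v y by (simp add: chain_append)
  moreover have "act v y \<in> carrier P \<times> S \<times> {0..<int k}" using v y by (intro act_closed) auto
  ultimately show ?thesis
    using u v y by (simp add: act_def cl_append m_assoc mod_add_left_eq add_ac)
qed

lemma act_trivial:
  assumes "cl w = \<one>" "\<And>g t. g \<in> carrier P \<Longrightarrow> int k dvd chain w g t"
    and "y \<in> carrier P \<times> S \<times> {0..<int k}"
  shows "act w y = y"
proof -
  obtain g t i where y: "y = (g, t, i)" "g \<in> carrier P" "t \<in> S" "i \<in> {0..<int k}"
    using assms(3) by (cases y) auto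
  have "(i + chain w g t) mod int k = i"
    using assms(2)[OF y(2), of t] y(4) by (metis add.right_neutral atLeastLessThan_iff dvd_imp_mod_0 mod_add_right_eq mod_pos_pos_trivial)
  then show ?thesis using y assms(1) by (simp add: act_def)
qed

lemma act_Nil: "y \<in> carrier P \<times> S \<times> {0..<int k} \<Longrightarrow> act [] y = y"
  by (rule act_trivial) (simp_all add: cl_Nil)

text \<open>The second letter runs back along the edge of the first, so the path is closed and its
  signed counts vanish.\<close>

lemma act_cancel:
  assumes s: "s \<in> S" and y: "y \<in> carrier P \<times> S \<times> {0..<int k}"
  shows "act [(s, b), (s, \<not> b)] y = y"
proof (rule act_trivial[OF _ _ y])
  show "cl [(s, b), (s, \<not> b)] = \<one>"
    using word_class_cancel[OF s, of R b] by (simp add: cl_Nil[symmetric]) (simp add: cl_def)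
  fix g t assume g: "g \<in> carrier P"
  have T: "cl [(s, True)] \<in> carrier P" using s by simp
  have F: "cl [(s, False)] = inv cl [(s, True)]" using cl_letter_inverse[OF s, of True] by simp
  have "inv cl [(s, True)] \<otimes> g = inv cl [(s, True)] \<longleftrightarrow> g = \<one>"
    using T g by simp
  moreover have "cl [(s, True)] \<otimes> g = \<one> \<longleftrightarrow> g = inv cl [(s, True)]"
    using T g by (metis inv_equality inv_inv r_inv)
  ultimately have "chain [(s, b), (s, \<not> b)] g t = 0"
    using T by (cases b) (simp_all add: F)
  then show "int k dvd chain [(s, b), (s, \<not> b)] g t" by simp
qed

text \<open>A closed path returns to \<open>\<one>\<close> before each repetition, so the
  repetitions cross the same edges and their counts add up.\<close>

lemma chain_power:
  assumes w: "w \<in> words S" "cl w = \<one>" and g: "g \<in> carrier P"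
  shows "concat (replicate j w) \<in> words S \<and> cl (concat (replicate j w)) = \<one> \<and>
    chain (concat (replicate j w)) g t = int j * chain w g t"
  using assms by (induction j) (auto simp: cl_Nil cl_append chain_append algebra_simps)

text \<open>The relators are \<open>k\<close>-th powers of closed paths, whose counts are divisible
  by \<open>k\<close>. They act trivially, and the action descends to the group presented by
  \<open>R'\<close>.\<close>

lemma act_pres_eq:
  assumes R': "\<And>r. r \<in> R' \<Longrightarrow> \<exists>w\<in>words S. cl w = \<one> \<and> r = concat (replicate k w)"
    and eq: "pres_eq S R' u v"
  shows "act u = act v"
  using eq
proof (induction rule: pres_eq.induct)
  case (cancel u v s b)
  show ?case
  proof (rule extensionalityI[of _ "carrier P \<times> S \<times> {0..<int k}"])
    fix y assume y: "y \<in> carrier P \<times> S \<times> {0..<int k}"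
    have "act (u @ [(s, b), (s, \<not> b)] @ v) y = act u (act [(s, b), (s, \<not> b)] (act v y))"
      using cancel y act_append[of u "[(s, b), (s, \<not> b)] @ v"] act_append[of "[(s, b), (s, \<not> b)]" v] by simp
    also have "\<dots> = act (u @ v) y"
      using cancel y by (simp add: act_cancel act_closed act_append)
    finally show "act (u @ [(s, b), (s, \<not> b)] @ v) y = act (u @ v) y" .
  qed (rule act_extensional)+
next
  case (relator u v r)
  obtain w where w: "w \<in> words S" "cl w = \<one>" "r = concat (replicate k w)"
    using R' relator by blast
  have r: "act r y = y" if "y \<in> carrier P \<times> S \<times> {0..<int k}" for y
    by (rule act_trivial[OF _ _ that]) (use chain_power[OF w(1,2)] w(3) one_closed in auto)
  show ?case
  proof (rule extensionalityI[of _ "carrier P \<times> S \<times> {0..<int k}"])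
    fix y assume y: "y \<in> carrier P \<times> S \<times> {0..<int k}"
    have "act (u @ r @ v) y = act u (act r (act v y))"
      using relator y act_append[of u "r @ v"] act_append[of r v] by simp
    also have "\<dots> = act (u @ v) y"
      using relator y by (simp add: r act_closed act_append)
    finally show "act (u @ r @ v) y = act (u @ v) y" .
  qed (rule act_extensional)+
qed auto

section \<open>Geodesics and the edges they cross\<close>

definition ball_class :: "nat \<Rightarrow> 's word set set"
  where "ball_class L = cl ` {w \<in> words S. length w \<le> L}"

definition crossed :: "'s word \<Rightarrow> ('s word set \<times> 's) set"
  where "crossed w = {(g, t) \<in> carrier P \<times> S. \<not> int k dvd chain w g t}"

text \<open>The last letter \<open>a\<close> of \<open>w @ [a]\<close> crosses exactly this edge.\<close>

definition last_edge :: "'s word \<Rightarrow> 's \<times> bool \<Rightarrow> 's word set \<times> 's"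
  where "last_edge w a = (if snd a then cl w else cl (w @ [a]), fst a)"

lemma last_edge_ends:
  assumes w: "w \<in> words S" and a: "fst a \<in> S" and e: "last_edge w a = (g, t)"
  shows "g \<in> carrier P" "t \<in> S" "{g, g \<otimes> cl [(t, True)]} = {cl w, cl (w @ [a])}"
proof -
  obtain s b where [simp]: "a = (s, b)" by (cases a)
  have s: "s \<in> S" using a by simp
  have F: "cl [(s, False)] = inv cl [(s, True)]" using cl_letter_inverse[OF s, of True] by simp
  have t: "t = s" using e by (simp add: last_edge_def)
  show "g \<in> carrier P" "t \<in> S" using e w s by (auto simp: last_edge_def)
  show "{g, g \<otimes> cl [(t, True)]} = {cl w, cl (w @ [a])}"
  proof -
    have "g = (if b then cl w else cl (w @ [(s, False)]))"
      using e[unfolded t] by (cases b) (auto simp: last_edge_def)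
    then show ?thesis
      unfolding t using w s by (cases b) (simp_all add: cl_append F m_assoc insert_commute)
  qed
qed

lemma chain_snoc:
  assumes w: "w \<in> words S" and a: "fst a \<in> S" and g: "g \<in> carrier P"
  shows "chain (w @ [a]) g t =
    chain w g t + (if (g, t) = last_edge w a then if snd a then 1 else - 1 else 0)"
proof -
  obtain s b where [simp]: "a = (s, b)" by (cases a)
  have s: "s \<in> S" using a by simp
  have "inv cl w \<otimes> g = \<one> \<longleftrightarrow> g = cl w"
    using w g by (metis cl_closed inv_closed inv_inv inv_equality l_inv r_inv)
  moreover have "inv cl w \<otimes> g = cl [(s, False)] \<longleftrightarrow> g = cl (w @ [(s, False)])"
    using w g s by (auto simp: cl_append inv_solve_left')
  ultimately show ?thesis
    using w a g s by (auto simp: chain_append last_edge_def)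
qed

text \<open>An edge with nonzero count was traversed by some letter, and both its ends are then
  values of prefixes of \<open>w\<close>.\<close>

lemma crossed_in_ball:
  assumes "w \<in> words S" "g \<in> carrier P" "t \<in> S" "chain w g t \<noteq> 0"
  shows "g \<in> ball_class (length w) \<and> g \<otimes> cl [(t, True)] \<in> ball_class (length w)"
  using assms
proof (induction w rule: rev_induct)
  case (snoc a w)
  have mono: "ball_class (length w) \<subseteq> ball_class (length (w @ [a]))" by (auto simp: ball_class_def)
  show ?case
  proof (cases "(g, t) = last_edge w a")
    case True
    then have "{g, g \<otimes> cl [(t, True)]} = {cl w, cl (w @ [a])}"
      using snoc last_edge_ends[of w a g t] by auto
    moreover have "{cl w, cl (w @ [a])} \<subseteq> ball_class (length (w @ [a]))"
      using snoc by (auto simp: ball_class_def)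
    ultimately have "{g, g \<otimes> cl [(t, True)]} \<subseteq> ball_class (length (w @ [a]))" by simp
    then show ?thesis by simp
  next
    case False
    then have "chain w g t \<noteq> 0" using snoc chain_snoc[of w a g t] by auto
    then show ?thesis using snoc mono by auto
  qed
qed simp

text \<open>Each further letter changes the count of a single edge.\<close>

lemma finite_crossed: "w \<in> words S \<Longrightarrow> finite (crossed w)"
proof (induction w rule: rev_induct)
  case (snoc a w)
  have "crossed (w @ [a]) \<subseteq> insert (last_edge w a) (crossed w)"
    using snoc by (auto simp: crossed_def chain_snoc split: if_splits)
  then show ?case using snoc by (auto intro: finite_subset)
qed (simp add: crossed_def)

text \<open>A geodesic ends at a vertex that no shorter word reaches, so its last edge is new. Each
  letter thus adds one edge, crossed exactly once.\<close>

lemma card_crossed_geodesic: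
  assumes "w \<in> words S" "\<And>v. v \<in> words S \<Longrightarrow> cl v = cl w \<Longrightarrow> length w \<le> length v"
  shows "card (crossed w) = length w"
  using assms
proof (induction w rule: rev_induct)
  case (snoc a w)
  then have w: "w \<in> words S" and a: "fst a \<in> S" by auto
  obtain g0 t0 where e: "last_edge w a = (g0, t0)" by (cases "last_edge w a")
  note ends = last_edge_ends[OF w a e]
  have "length w \<le> length v" if v: "v \<in> words S" "cl v = cl w" for v
    using snoc.prems(2)[of "v @ [a]"] v w a by (simp add: cl_append)
  then have IH: "card (crossed w) = length w" using snoc.IH w by blast
  have "cl (w @ [a]) \<notin> ball_class (length w)"
    using snoc.prems(2) by (force simp: ball_class_def)
  then have zero: "chain w g0 t0 = 0"
    using crossed_in_ball[OF w ends(1,2)] ends(3) by (metis insert_iff singletonD)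
  \<comment> \<open>A single crossing remains visible modulo \<open>k\<close> because
    \<open>k > 1\<close>.\<close>
  have "\<not> int k dvd 1" "\<not> int k dvd - 1" using k by auto
  then have "\<not> int k dvd chain (w @ [a]) g0 t0"
    using zero by (simp add: chain_snoc[OF w a ends(1)] e)
  then have "crossed (w @ [a]) = insert (g0, t0) (crossed w)"
    using ends(1,2) by (auto simp: crossed_def chain_snoc[OF w a] e split: if_splits)
  moreover have "(g0, t0) \<notin> crossed w" using zero by (simp add: crossed_def)
  ultimately show ?case using IH finite_crossed[OF w] by simp
qed (simp add: crossed_def)

text \<open>Balls are finite as there are finitely many generators, so the infinite group has an
  element outside the ball of radius \<open>L\<close>. Take a shortest word for it.\<close>

lemma long_geodesic:
  obtains w where "w \<in> words S" "L \<le> length w"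
    "\<And>v. v \<in> words S \<Longrightarrow> cl v = cl w \<Longrightarrow> length w \<le> length v"
proof -
  have "{w \<in> words S. length w \<le> L} = {w. set w \<subseteq> S \<times> UNIV \<and> length w \<le> L}"
    by (auto simp: words_def)
  then have "finite (ball_class L)"
    unfolding ball_class_def using finite_gens
    by (simp only:) (intro finite_imageI finite_lists_length_le finite_cartesian_product finite)
  then have "\<not> carrier P \<subseteq> ball_class L" using infinite_group by (auto dest: finite_subset)
  then obtain A where A: "A \<in> carrier P" "A \<notin> ball_class L" by blast
  then obtain u where u: "u \<in> words S \<and> cl u = A" by (auto simp: carrier_P)
  have "\<exists>w. (w \<in> words S \<and> cl w = A) \<and> (\<forall>v. (v \<in> words S \<and> cl v = A) \<longrightarrow> length w \<le> length v)"
    using u by (rule ex_has_least_nat[where P = "\<lambda>w. w \<in> words S \<and> cl w = A"])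
  then obtain w where w: "w \<in> words S" "cl w = A"
    and min: "\<forall>v. (v \<in> words S \<and> cl v = A) \<longrightarrow> length w \<le> length v" by (elim exE conjE)
  have "L \<le> length w"
  proof (rule ccontr)
    assume "\<not> L \<le> length w"
    then have "A \<in> ball_class L" using w unfolding ball_class_def by (intro image_eqI[of _ _ w]) auto
    with A(2) show False ..
  qed
  then show thesis using w min by (intro that[of w]) auto
qed

section \<open>The zero sheet and its displacement\<close>

definition base_sheet :: "('s word set \<times> 's \<times> int) set"
  where "base_sheet = carrier P \<times> S \<times> {0}"

text \<open>Translation permutes the edges, so the image of the zero sheet is again a section over
  all edges: the graph of the counts modulo \<open>k\<close>.\<close>

lemma act_base_sheet:
  assumes w: "w \<in> words S"
  shows "act w ` base_sheet = {(g, t, i). g \<in> carrier P \<and> t \<in> S \<and> i = chain w g t mod int k}"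
proof (intro equalityI subsetI)
  fix y assume "y \<in> act w ` base_sheet"
  then show "y \<in> {(g, t, i). g \<in> carrier P \<and> t \<in> S \<and> i = chain w g t mod int k}"
    using w k by (auto simp: base_sheet_def act_def)
next
  fix y assume "y \<in> {(g, t, i). g \<in> carrier P \<and> t \<in> S \<and> i = chain w g t mod int k}"
  then obtain g t where y: "y = (g, t, chain w g t mod int k)" "g \<in> carrier P" "t \<in> S" by auto
  have "cl w \<otimes> (inv cl w \<otimes> g) = g" using w y by (simp add: m_assoc[symmetric])
  then have "y = act w (inv cl w \<otimes> g, t, 0)" using w y k by (simp add: act_def)
  then show "y \<in> act w ` base_sheet" using w y by (auto simp: base_sheet_def)
qed

lemma finite_sheet_defect:
  assumes w: "w \<in> words S"
  shows "finite (sym_diff (act w ` base_sheet) base_sheet)"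
proof (rule finite_subset)
  show "sym_diff (act w ` base_sheet) base_sheet \<subseteq> (\<lambda>((g, t), i). (g, t, i)) ` (crossed w \<times> {0..<int k})"
    unfolding act_base_sheet[OF w] using k
    by (force simp: base_sheet_def crossed_def dvd_eq_mod_eq_0 image_iff)
  show "finite ((\<lambda>((g, t), i). (g, t, i)) ` (crossed w \<times> {0..<int k}))"
    using finite_crossed[OF w] by simp
qed

text \<open>Over every crossed edge the sheet has left level 0, so the point at level 0 belongs to
  the difference.\<close>

lemma card_crossed_le_defect:
  assumes w: "w \<in> words S"
  shows "card (crossed w) \<le> card (sym_diff (act w ` base_sheet) base_sheet)"
proof (rule card_inj_on_le[of "\<lambda>(g, t). (g, t, 0)"])
  show "(\<lambda>(g, t). (g, t, 0)) ` crossed w \<subseteq> sym_diff (act w ` base_sheet) base_sheet"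
    unfolding act_base_sheet[OF w] by (auto simp: base_sheet_def crossed_def dvd_eq_mod_eq_0)
  show "finite (sym_diff (act w ` base_sheet) base_sheet)" by (rule finite_sheet_defect[OF w])
qed (auto simp: inj_on_def)

lemma commensurating_action_exists:
  assumes R': "\<And>r. r \<in> R' \<Longrightarrow> \<exists>w\<in>words S. cl w = \<one> \<and> r = concat (replicate k w)"
  obtains \<psi> B where "commensurating_action (presented_group S R') \<psi> B"
proof -
  let ?G = "presented_group S R'" let ?Y = "carrier P \<times> S \<times> {0..<int k}"
  \<comment> \<open>By \<open>act_pres_eq\<close> the action is constant on classes, so the choice
    of representative does not matter.\<close>
  define \<phi> where "\<phi> A = act (SOME w. w \<in> A)" for A :: "'s word set"
  note elem = word_class_of_element[of _ S R']
  have \<phi>: "\<phi> (word_class S R' w) = act w" if w: "w \<in> words S" for w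
  proof -
    have "word_class S R' w \<in> carrier ?G" using w by (auto simp: carrier_presented_group)
    from elem(2)[OF this] have "pres_eq S R' w (SOME v. v \<in> word_class S R' w)"
      using word_class_eq_iff[OF w] by metis
    then show ?thesis using act_pres_eq[OF R'] by (simp add: \<phi>_def)
  qed
  have "group_action ?G ?Y \<phi>"
  proof (rule group_actionI)
    show "group ?G" by (rule group_presented_group)
    show "\<phi> A y \<in> ?Y" if "A \<in> carrier ?G" "y \<in> ?Y" for A y
      unfolding \<phi>_def using elem(1)[OF that(1)] that(2) by (rule act_closed)
    show "\<phi> A \<in> extensional ?Y" for A unfolding \<phi>_def by (rule act_extensional)
    show "\<phi> \<one>\<^bsub>?G\<^esub> y = y" if "y \<in> ?Y" for y
      using act_Nil[OF that] \<phi>[of "[]"] by (simp add: one_presented_group)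
    show "\<phi> (A \<otimes>\<^bsub>?G\<^esub> A') y = \<phi> A (\<phi> A' y)" if "A \<in> carrier ?G" "A' \<in> carrier ?G" "y \<in> ?Y" for A A' y
      using that by (auto simp: carrier_presented_group mult_presented_group \<phi> act_append)
  qed
  moreover have "countable ?Y"
    using countable_presented_group[of S R] finite_gens
    by (simp add: P_def countable_finite)
  moreover have "base_sheet \<subseteq> ?Y" using k by (auto simp: base_sheet_def)
  moreover have "finite (sym_diff (\<phi> A ` base_sheet) base_sheet)" if "A \<in> carrier ?G" for A
    unfolding \<phi>_def using elem(1)[OF that] by (rule finite_sheet_defect)
  \<comment> \<open>A word that is geodesic in \<open>P\<close> is read as an element of the group
    presented by \<open>R'\<close>.\<close>
  moreover have "\<exists>A\<in>carrier ?G. N \<le> card (sym_diff (\<phi> A ` base_sheet) base_sheet)" for N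
  proof (rule long_geodesic[of N])
    fix w assume w: "w \<in> words S" "N \<le> length w"
      "\<And>v. v \<in> words S \<Longrightarrow> cl v = cl w \<Longrightarrow> length w \<le> length v"
    have "N \<le> card (sym_diff (act w ` base_sheet) base_sheet)"
      using card_crossed_geodesic[OF w(1,3)] card_crossed_le_defect[OF w(1)] w(2) by linarith
    then show ?thesis
      using w(1) by (intro bexI[of _ "word_class S R' w"]) (auto simp: \<phi> carrier_presented_group)
  qed
  ultimately show thesis
    using that by (rule commensurating_action_transport[of ?G ?Y \<phi> base_sheet])
qed

end

section \<open>Application to free Burnside groups\<close>

theorem theorem1:
  fixes m n k :: nat
  assumes "m \<ge> 1" and "n \<ge> 1"
    and "infinite (carrier (burnside_group m n))"
    and "k > 1"
  shows "(\<exists>(K :: (nat \<Rightarrow> real) cubes) \<rho>.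
            CAT0_cubical_complex K \<and> complex_points K \<noteq> {} \<and>
            acts_cubically (burnside_group m (k * n)) K \<rho> \<and>
            \<not> has_fixed_point (burnside_group m (k * n)) (complex_points K) \<rho>)
         \<and> \<not> property_T (burnside_group m (k * n))"
proof -
  let ?R = "\<lambda>n. {concat (replicate n w) | w. w \<in> words {1..m}}"
  interpret cubization "{1..m}" "?R n" k "burnside_group m n"
    using assms by unfold_locales (simp_all add: burnside_group_def)
  have power: "concat (replicate (k * n) w) = concat (replicate k (concat (replicate n w)))" for w :: "nat word"
    by (induction k) (simp_all add: replicate_add)
  have "\<exists>w\<in>words {1..m}. cl w = \<one>\<^bsub>burnside_group m n\<^esub> \<and> r = concat (replicate k w)" if r: "r \<in> ?R (k * n)" for r
  proof -
    obtain w where w: "w \<in> words {1..m}" "r = concat (replicate (k * n) w)" using r by blast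
    have u: "concat (replicate n w) \<in> words {1..m}" using w(1) by (induction n) simp_all
    \<comment> \<open>The word \<open>concat (replicate n w)\<close> is itself a relator of the
      smaller group, hence a closed path there; the relators for the exponent \<open>k * n\<close>
      are its \<open>k\<close>-th powers.\<close>
    then have "pres_eq {1..m} (?R n) ([] @ concat (replicate n w) @ []) ([] @ [])"
      using w(1) by (intro pres_eq.relator) auto
    then have "cl (concat (replicate n w)) = \<one>\<^bsub>burnside_group m n\<^esub>"
      unfolding cl_Nil[symmetric] cl_def word_class_eq_iff[OF u] by (simp only: append_Nil append_Nil2)
    then show ?thesis using u w(2) power by blast
  qed
  then obtain \<psi> B where "commensurating_action (presented_group {1..m} (?R (k * n))) \<psi> B"
    by (rule commensurating_action_exists)
  then interpret C: commensurating_action "burnside_group m (k * n)" \<psi> B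
    unfolding burnside_group_def .
  \<comment> \<open>Group elements are sets of words here, so a set of naturals is encoded by the
    set of the corresponding one-letter words.\<close>
  have "inj (\<lambda>j :: nat. [(j, True)])" by (simp add: inj_def)
  then have "inj (\<lambda>C :: nat set. ((\<lambda>j. [(j, True)]) ` C, 0 :: nat))"
    by (intro injI) (simp add: inj_image_eq_iff)
  then have "\<not> property_T (burnside_group m (k * n))" by (intro C.not_property_T) blast
  moreover have "complex_points (cube_cubes B) \<noteq> {}"
    using base_vertex[of B] by (auto simp: complex_points_cube cube_vertices_def)
  ultimately show ?thesis
    using CAT0_cubical_complex_cube[of B] C.acts_cubically_cube C.no_fixed_point_cube
    by (metis complex_points_cube)
qed

end
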